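(* Let $H\in(1/2,1)$, $\kappa,\lambda>0$, $g=(g_i)_{i\in\mathbb{Z}}\in\ell^2$, $\sigma=(\sigma_i)_{i\in\mathbb{Z}}\in\ell^2$, and let $f_i:\mathbb{R}\to\mathbb{R}$ ($i\in\mathbb{Z}$) be continuously differentiable functions such that $f(x)=(f_i(x_i))_{i\in\mathbb{Z}}$ maps $\ell^2$ into $\ell^2$. Assume that there are constants $L>0$, $K>0$, $p\ge 1$ with $$\langle x-y, f(x)-f(y)\rangle\le -L|x-y|^2\quad\text{for all }x,y\in\ell^2,\qquad |f(x)|+|Df(x)|\le K(1+|x|^p)\quad\text{for all }x\in\ell^2 .$$ For $\omega\in\Omega$ and $u_0\in\ell^2$ let $u=(u(t))_{t\ge0}$ be the unique pathwise solution of $u(t)=u_0+\int_0^t(-\kappa Au(s)-\lambda u(s)+f(u(s))+g)\,ds+W(t,\omega)$, $t\ge0$. Then this solution determines a continuous random dynamical system $\varphi:\mathbb{R}^+\times\Omega\times\ell^2\to\ell^2$ over $(\Omega,\mathcal{F},\mathbb{P},(\theta_t)_{t\in\mathbb{R}})$, which is given by $$\varphi(t,\omega,u_0)=u_0+\int_0^t\bigl(-\kappa Au(s)-\lambda u(s)+f(u(s))+g\bigr)\,ds+W(t,\omega).$$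
   Context: $\ell^2=\ell^2(\mathbb{Z})$ is the real Hilbert space of square-summable sequences with inner product $\langle\cdot,\cdot\rangle$ and norm $|\cdot|$; $e^i\in\ell^2$ is the element with 1 at position $i$ and 0 elsewhere. $A:\ell^2\to\ell^2$ is the linear operator $(Ax)_i=-x_{i-1}+2x_i-x_{i+1}$. $Df$ is the derivative of $f$. Noise. A two-sided one-dimensional fractional Brownian motion (fBm) with Hurst parameter $H$ is a continuous centered Gaussian process $\beta^H(t)$, $t\in\mathbb{R}$, with $\mathbf{E}\,\beta^H(t)\beta^H(s)=\frac12(|t|^{2H}+|s|^{2H}-|t-s|^{2H})$. The canonical interpretation is used: $\Omega=C_0(\mathbb{R},\ell^2)$ is the space of continuous functions $\omega:\mathbb{R}\to\ell^2$ with $\omega(0)=0$, equipped with the compact open topology; $\mathcal{F}$ is its Borel $\sigma$-algebra; $\mathbb{P}$ is the distribution of the fBm, with $\beta^H(\cdot,\omega)=\omega(\cdot)$ and coordinates $\omega_i=\beta_i^H$, $i\in\mathbb{Z}$, independent two-sided fBms with Hurst parameter $H$; and $(\theta_t\omega)(\cdot)=\omega(\cdot+t)-\omega(t)$, $t\in\mathbb{R}$, so that $(\Omega,\mathcal{F},\mathbb{P},(\theta_t)_{t\in\mathbb{R}})$ is an ergodic metric dynamical system. The noise is $W(t,\omega)=\sum_{i\in\mathbb{Z}}\sigma_i\omega_i(t)e^i$. The metric dynamical system is restricted (keeping the same symbols, with the trace $\sigma$-algebra) to a $(\theta_t)$-invariant set of full measure on which $|W(t,\omega)|\le\rho(\omega)(1+|t|^2)$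 for all $t\in\mathbb{R}$, for some random constant $\rho(\omega)>0$. A continuous random dynamical system on a separable Hilbert space $\mathbb{E}$ over $(\Omega,\mathcal{F},\mathbb{P},(\theta_t)_{t\in\mathbb{R}})$ is a $(\mathcal{B}(\mathbb{R}^+)\times\mathcal{F}\times\mathcal{B}(\mathbb{E}),\mathcal{B}(\mathbb{E}))$-measurable map $\varphi:\mathbb{R}^+\times\Omega\times\mathbb{E}\to\mathbb{E}$ such that (i) $\varphi(0,\omega,\cdot)=\mathrm{id}_{\mathbb{E}}$; (ii) $\varphi(t+s,\omega,\cdot)=\varphi(t,\theta_s\omega,\cdot)\circ\varphi(s,\omega,\cdot)$ for all $s,t\in\mathbb{R}^+$, $\omega\in\Omega$; (iii) $\varphi(t,\omega,\cdot)$ is continuous on $\mathbb{E}$ for all $(t,\omega)\in\mathbb{R}^+\times\Omega$.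
   Formalization: Independent standard fBm coordinates are a.s. not square-summable, so no such P lives on C_0(R,ℓ²); here Ω is an invariant full-measure set of continuous paths into R^Z (product topology) on which W(t,ω) converges in ℓ², is continuous in t and has the stated growth bound. *)

theory Defs
  imports "HOL-Probability.Probability"
begin

section \<open>The real Hilbert space of square-summable two-sided sequences\<close>

definition square_summable :: "(int \<Rightarrow> real) \<Rightarrow> bool"
  where "square_summable x \<longleftrightarrow> (\<lambda>i. (x i)\<^sup>2) summable_on UNIV"

lemma square_summable_zero: "square_summable (\<lambda>_. 0)"
  by (simp add: square_summable_def)

lemma square_summable_scale:
  assumes "square_summable x" shows "square_summable (\<lambda>i. c * x i)"
  using assms by (simp add: square_summable_def power_mult_distrib summable_on_cmult_right)

lemma square_summable_add:
  assumes "square_summable x" "square_summable y" shows "square_summable (\<lambda>i. x i + y i)"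
proof -
  have s: "(\<lambda>i. 2 * (x i)\<^sup>2 + 2 * (y i)\<^sup>2) summable_on UNIV"
    using assms by (auto simp: square_summable_def intro!: summable_on_add summable_on_cmult_right)
  have le: "(x i + y i)\<^sup>2 \<le> 2 * (x i)\<^sup>2 + 2 * (y i)\<^sup>2" for i
    using zero_le_power2[of "x i - y i"] by (simp add: power2_sum power2_diff)
  show ?thesis
    unfolding square_summable_def by (rule summable_on_comparison_test[OF s]) (use le in auto)
qed

lemma square_summable_diff:
  assumes "square_summable x" "square_summable y" shows "square_summable (\<lambda>i. x i - y i)"
  using square_summable_add[OF assms(1) square_summable_scale[OF assms(2), of "-1"]] by simp

lemma square_summable_shift:
  assumes "square_summable x" shows "square_summable (\<lambda>i. x (i + k))"
proof -
  have "bij_betw (\<lambda>i::int. i + k) UNIV UNIV"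
    by (rule bij_betwI[where g="\<lambda>i. i - k"]) auto
  from summable_on_reindex_bij_betw[OF this, of "\<lambda>i. (x i)\<^sup>2"] assms show ?thesis
    by (simp add: square_summable_def)
qed

lemma square_summable_prod:
  assumes "square_summable x" "square_summable y" shows "(\<lambda>i. x i * y i) summable_on UNIV"
proof -
  have "x i * y i = (1/4) * ((x i + y i)\<^sup>2 + (- 1) * (x i - y i)\<^sup>2)" for i
    by (simp add: power2_sum power2_diff)
  moreover have "(\<lambda>i. (1/4) * ((x i + y i)\<^sup>2 + (- 1) * (x i - y i)\<^sup>2)) summable_on UNIV"
    using square_summable_add[OF assms] square_summable_diff[OF assms] unfolding square_summable_def
    by (intro summable_on_cmult_right summable_on_add)
  ultimately show ?thesis by (simp only:)
qed

typedef ell2 = "Collect square_summable"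
  morphisms coord Abs_ell2
  using square_summable_zero by auto

lemma square_summable_coord [simp]: "square_summable (coord x)"
  using coord by auto

lemma coord_Abs_ell2: "square_summable x \<Longrightarrow> coord (Abs_ell2 x) = x"
  by (simp add: Abs_ell2_inverse)

lemma ell2_eqI: "(\<And>i. coord x i = coord y i) \<Longrightarrow> x = y"
  using coord_inject by blast

instantiation ell2 :: real_inner
begin

definition zero_ell2 :: ell2 where "0 = Abs_ell2 (\<lambda>_. 0)"
definition plus_ell2 :: "ell2 \<Rightarrow> ell2 \<Rightarrow> ell2" where "x + y = Abs_ell2 (\<lambda>i. coord x i + coord y i)"
definition minus_ell2 :: "ell2 \<Rightarrow> ell2 \<Rightarrow> ell2" where "x - y = Abs_ell2 (\<lambda>i. coord x i - coord y i)"
definition uminus_ell2 :: "ell2 \<Rightarrow> ell2" where "- x = Abs_ell2 (\<lambda>i. - coord x i)"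
definition scaleR_ell2 :: "real \<Rightarrow> ell2 \<Rightarrow> ell2" where "c *\<^sub>R x = Abs_ell2 (\<lambda>i. c * coord x i)"
definition inner_ell2 :: "ell2 \<Rightarrow> ell2 \<Rightarrow> real" where "x \<bullet> y = (\<Sum>\<^sub>\<infinity>i. coord x i * coord y i)"
definition norm_ell2 :: "ell2 \<Rightarrow> real" where "norm (x::ell2) = sqrt (x \<bullet> x)"
definition dist_ell2 :: "ell2 \<Rightarrow> ell2 \<Rightarrow> real" where "dist (x::ell2) y = norm (x - y)"
definition sgn_ell2 :: "ell2 \<Rightarrow> ell2" where "sgn (x::ell2) = inverse (norm x) *\<^sub>R x"
definition uniformity_ell2 :: "(ell2 \<times> ell2) filter"
  where "uniformity = (INF e\<in>{0<..}. principal {(x::ell2, y). dist x y < e})"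
definition open_ell2 :: "ell2 set \<Rightarrow> bool"
  where "open (U::ell2 set) = (\<forall>x\<in>U. \<forall>\<^sub>F (x', y) in uniformity. x' = x \<longrightarrow> y \<in> U)"

lemma coord_zero: "coord 0 i = 0"
  by (simp add: zero_ell2_def coord_Abs_ell2 square_summable_zero)

lemma coord_add: "coord (x + y) i = coord x i + coord y i"
  by (simp add: plus_ell2_def coord_Abs_ell2 square_summable_add)

lemma coord_diff: "coord (x - y) i = coord x i - coord y i"
  by (simp add: minus_ell2_def coord_Abs_ell2 square_summable_diff)

lemma coord_uminus: "coord (- x) i = - coord x i"
  using square_summable_scale[OF square_summable_coord, of "-1" x]
  by (simp add: uminus_ell2_def coord_Abs_ell2)

lemma coord_scaleR: "coord (c *\<^sub>R x) i = c * coord x i"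
  by (simp add: scaleR_ell2_def coord_Abs_ell2 square_summable_scale)

lemmas coord_simps = coord_zero coord_add coord_diff coord_uminus coord_scaleR

instance
proof
  fix x y z :: ell2 and a b :: real and U :: "ell2 set"
  show "x + y + z = x + (y + z)" "x + y = y + x" "0 + x = x" "- x + x = 0" "x - y = x + - y"
    "a *\<^sub>R (x + y) = a *\<^sub>R x + a *\<^sub>R y" "(a + b) *\<^sub>R x = a *\<^sub>R x + b *\<^sub>R x"
    "a *\<^sub>R b *\<^sub>R x = (a * b) *\<^sub>R x" "1 *\<^sub>R x = x"
    by (auto intro!: ell2_eqI simp: coord_simps algebra_simps)
  show "dist x y = norm (x - y)" by (rule dist_ell2_def)
  show "sgn x = inverse (norm x) *\<^sub>R x" by (rule sgn_ell2_def)
  show "uniformity = (INF e\<in>{0<..}. principal {(x, y::ell2). dist x y < e})"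
    by (rule uniformity_ell2_def)
  show "open U = (\<forall>x\<in>U. \<forall>\<^sub>F (x', y) in uniformity. x' = x \<longrightarrow> y \<in> U)" by (rule open_ell2_def)
  show "norm x = sqrt (x \<bullet> x)" by (rule norm_ell2_def)
  show "x \<bullet> y = y \<bullet> x" by (simp add: inner_ell2_def mult.commute)
  show "(x + y) \<bullet> z = x \<bullet> z + y \<bullet> z"
    by (simp add: inner_ell2_def coord_simps distrib_right infsum_add square_summable_prod)
  show "a *\<^sub>R x \<bullet> y = a * (x \<bullet> y)"
    by (simp add: inner_ell2_def coord_simps mult.assoc infsum_cmult_right')
  show "0 \<le> x \<bullet> x" by (simp add: inner_ell2_def infsum_nonneg)
  show "x \<bullet> x = 0 \<longleftrightarrow> x = 0"
  proof
    assume "x \<bullet> x = 0"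
    then have "coord x i * coord x i = 0" for i
      using nonneg_infsum_le_0D[of "\<lambda>i. coord x i * coord x i" UNIV i]
      by (auto simp: inner_ell2_def square_summable_prod)
    then show "x = 0" by (auto intro!: ell2_eqI simp: coord_simps)
  qed (simp add: inner_ell2_def coord_simps)
qed

end

definition unit_seq :: "int \<Rightarrow> ell2"
  where "unit_seq i = Abs_ell2 (\<lambda>j. if j = i then 1 else 0)"

lemma coord_unit_seq: "coord (unit_seq i) j = (if j = i then 1 else 0)"
proof -
  have "(\<lambda>j. (if j = i then 1 else (0::real))\<^sup>2) summable_on {i}"
    by (rule summable_on_finite) simp
  then have "square_summable (\<lambda>j. if j = i then 1 else 0)"
    unfolding square_summable_def by (rule summable_on_cong_neutral[THEN iffD1, rotated -1]) auto
  then show ?thesis by (simp add: unit_seq_def coord_Abs_ell2)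
qed

definition lattice_op :: "ell2 \<Rightarrow> ell2"
  where "lattice_op x = Abs_ell2 (\<lambda>i. - coord x (i - 1) + 2 * coord x i - coord x (i + 1))"

lemma coord_lattice_op:
  "coord (lattice_op x) i = - coord x (i - 1) + 2 * coord x i - coord x (i + 1)"
proof -
  have "square_summable (\<lambda>i. (2 * coord x i - coord x (i + (- 1))) - coord x (i + 1))"
    by (intro square_summable_diff square_summable_scale square_summable_shift square_summable_coord)
  then show ?thesis
    by (simp add: lattice_op_def coord_Abs_ell2 algebra_simps)
qed

text \<open>The operator \<open>f(x) = (f\<^sub>i(x\<^sub>i))\<^sub>i\<close>; meaningful when it maps square-summable
  sequences to square-summable sequences.\<close>

definition superpos :: "(int \<Rightarrow> real \<Rightarrow> real) \<Rightarrow> ell2 \<Rightarrow> ell2"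
  where "superpos f x = Abs_ell2 (\<lambda>i. f i (coord x i))"

text \<open>Continuous differentiability of every \<open>f\<^sub>i\<close> does not by itself make the superposition
  operator Frechet differentiable, so the derivative \<open>Df(x)\<close> is only required to be a bounded
  Gateaux derivative. A Frechet derivative is one, and so is the diagonal operator
  \<open>h \<mapsto> (f\<^sub>i'(x\<^sub>i) h\<^sub>i)\<^sub>i\<close> if its norm is locally bounded in \<open>x\<close>.\<close>

definition has_gateaux_derivative ::
    "('a::real_normed_vector \<Rightarrow> 'b::real_normed_vector) \<Rightarrow> ('a \<Rightarrow> 'b) \<Rightarrow> 'a \<Rightarrow> bool"
  where "has_gateaux_derivative F D x \<longleftrightarrow>
    bounded_linear D \<and> (\<forall>h. ((\<lambda>s. F (x + s *\<^sub>R h)) has_vector_derivative D h) (at 0))"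

section \<open>Fractional Brownian motion and its canonical path space\<close>

definition gaussian_rv :: "'w measure \<Rightarrow> ('w \<Rightarrow> real) \<Rightarrow> bool"
  where "gaussian_rv M X \<longleftrightarrow> X \<in> borel_measurable M \<and>
    (\<exists>m. (AE w in M. X w = m) \<or> (\<exists>s>0. distributed M lborel X (normal_density m s)))"

definition gaussian_process :: "'w measure \<Rightarrow> ('t \<Rightarrow> 'w \<Rightarrow> real) \<Rightarrow> bool"
  where "gaussian_process M X \<longleftrightarrow>
    (\<forall>J c. finite J \<longrightarrow> gaussian_rv M (\<lambda>w. \<Sum>t\<in>J. c t * X t w))"

definition two_sided_fbm :: "'w measure \<Rightarrow> real \<Rightarrow> (real \<Rightarrow> 'w \<Rightarrow> real) \<Rightarrow> bool"
  where "two_sided_fbm M H X \<longleftrightarrow>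
    (\<forall>w\<in>space M. continuous_on UNIV (\<lambda>t. X t w)) \<and>
    gaussian_process M X \<and>
    (\<forall>t. prob_space.expectation M (X t) = 0) \<and>
    (\<forall>t s. prob_space.expectation M (\<lambda>w. X t w * X s w) =
      (\<bar>t\<bar> powr (2 * H) + \<bar>s\<bar> powr (2 * H) - \<bar>t - s\<bar> powr (2 * H)) / 2)"

text \<open>Independent identically distributed coordinates are almost surely not square-summable.
  So a measure under which \<open>(\<omega>\<^sub>i)\<^sub>i\<close> are independent standard fractional Brownian motions
  cannot live on the paths with values in the Hilbert space, but only on the paths with values in
  the space \<open>int \<Rightarrow> real\<close> of all sequences (with the product topology), which contain the
  former. The noise \<open>W\<close>, with weights \<open>\<sigma>\<close>, does take values in the Hilbert space.\<close>

type_synonym path = "real \<Rightarrow> int \<Rightarrow> real"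

definition path_space :: "path set"
  where "path_space = {\<omega>. continuous_on UNIV \<omega> \<and> \<omega> 0 = (\<lambda>_. 0)}"

definition compact_open_topology :: "path topology"
  where "compact_open_topology =
    topology_generated_by {{\<omega> \<in> path_space. \<omega> ` C \<subseteq> U} | C U. compact C \<and> open U}"

definition path_borel :: "path measure"
  where "path_borel = sigma path_space {U. openin compact_open_topology U}"

text \<open>Independence of the coordinates is that of the whole processes, that is, of the
  random elements \<open>\<omega> \<mapsto> (\<omega>\<^sub>i(t))\<^sub>t\<close> of the product measurable space.\<close>

definition fbm_distribution :: "real \<Rightarrow> path measure \<Rightarrow> bool"
  where "fbm_distribution H P \<longleftrightarrow>
    prob_space P \<and> sets P = sets path_borel \<and>
    (\<forall>i. two_sided_fbm P H (\<lambda>t \<omega>. \<omega> t i)) \<and>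
    prob_space.indep_vars P (\<lambda>_. PiM UNIV (\<lambda>_. borel)) (\<lambda>i \<omega>. \<lambda>t. \<omega> t i) UNIV"

definition path_shift :: "real \<Rightarrow> path \<Rightarrow> path"
  where "path_shift t \<omega> = (\<lambda>s i. \<omega> (s + t) i - \<omega> t i)"

definition noise_converges :: "ell2 \<Rightarrow> path \<Rightarrow> bool"
  where "noise_converges \<sigma> \<omega> \<longleftrightarrow>
    (\<forall>t. (\<lambda>i. (coord \<sigma> i * \<omega> t i) *\<^sub>R unit_seq i) summable_on UNIV)"

definition noise :: "ell2 \<Rightarrow> real \<Rightarrow> path \<Rightarrow> ell2"
  where "noise \<sigma> t \<omega> = (\<Sum>\<^sub>\<infinity>i. (coord \<sigma> i * \<omega> t i) *\<^sub>R unit_seq i)"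

section \<open>Random dynamical systems\<close>

definition metric_dynamical_system :: "'w measure \<Rightarrow> (real \<Rightarrow> 'w \<Rightarrow> 'w) \<Rightarrow> bool"
  where "metric_dynamical_system M \<theta> \<longleftrightarrow>
    prob_space M \<and>
    (\<lambda>(t, w). \<theta> t w) \<in> borel \<Otimes>\<^sub>M M \<rightarrow>\<^sub>M M \<and>
    (\<forall>w\<in>space M. \<theta> 0 w = w) \<and>
    (\<forall>t s. \<forall>w\<in>space M. \<theta> (t + s) w = \<theta> t (\<theta> s w)) \<and>
    (\<forall>t. distr M M (\<theta> t) = M)"

definition ergodic_mds :: "'w measure \<Rightarrow> (real \<Rightarrow> 'w \<Rightarrow> 'w) \<Rightarrow> bool"
  where "ergodic_mds M \<theta> \<longleftrightarrow> metric_dynamical_system M \<theta> \<and>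
    (\<forall>A\<in>sets M. (\<forall>t. \<theta> t -` A \<inter> space M = A) \<longrightarrow> measure M A = 0 \<or> measure M A = 1)"

definition continuous_rds ::
    "'w measure \<Rightarrow> (real \<Rightarrow> 'w \<Rightarrow> 'w) \<Rightarrow> (real \<Rightarrow> 'w \<Rightarrow> 'e::topological_space \<Rightarrow> 'e) \<Rightarrow> bool"
  where "continuous_rds M \<theta> \<phi> \<longleftrightarrow>
    metric_dynamical_system M \<theta> \<and>
    (\<lambda>(t, w, x). \<phi> t w x) \<in> restrict_space borel {0..} \<Otimes>\<^sub>M M \<Otimes>\<^sub>M borel \<rightarrow>\<^sub>M borel \<and>
    (\<forall>w\<in>space M. \<forall>x. \<phi> 0 w x = x) \<and>
    (\<forall>s\<ge>0. \<forall>t\<ge>0. \<forall>w\<in>space M. \<phi> (t + s) w = \<phi> t (\<theta> s w) \<circ> \<phi> s w) \<and>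
    (\<forall>t\<ge>0. \<forall>w\<in>space M. continuous_on UNIV (\<phi> t w))"

section \<open>The lattice equation\<close>

definition drift :: "real \<Rightarrow> real \<Rightarrow> (int \<Rightarrow> real \<Rightarrow> real) \<Rightarrow> ell2 \<Rightarrow> ell2 \<Rightarrow> ell2"
  where "drift \<kappa> lam f g x = - (\<kappa> *\<^sub>R lattice_op x) - lam *\<^sub>R x + superpos f x + g"

text \<open>A solution lives on \<open>[0, \<infinity>)\<close>; the values of \<open>u\<close> at negative times are irrelevant.\<close>

definition pathwise_solution :: "(ell2 \<Rightarrow> ell2) \<Rightarrow> (real \<Rightarrow> ell2) \<Rightarrow> ell2 \<Rightarrow> (real \<Rightarrow> ell2) \<Rightarrow> bool"
  where "pathwise_solution G w u0 u \<longleftrightarrow>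
    continuous_on {0..} u \<and>
    (\<forall>t\<ge>0. (\<lambda>s. G (u s)) integrable_on {0..t} \<and>
      u t = u0 + integral {0..t} (\<lambda>s. G (u s)) + w t)"

definition unique_pathwise_solution ::
    "(ell2 \<Rightarrow> ell2) \<Rightarrow> (real \<Rightarrow> ell2) \<Rightarrow> ell2 \<Rightarrow> (real \<Rightarrow> ell2) \<Rightarrow> bool"
  where "unique_pathwise_solution G w u0 u \<longleftrightarrow>
    pathwise_solution G w u0 u \<and>
    (\<forall>v. pathwise_solution G w u0 v \<longrightarrow> (\<forall>t\<ge>0. v t = u t))"

end

(* The drift is Lipschitz on balls (mean value inequality along segments) and dissipative.
   Composed with the radial retraction onto a ball it is globally Lipschitz, so Picard iteration
   converges on all of [0, oo); an a priori bound that is uniform in the radius shows that for large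
   radii the truncated solutions are solutions of the original equation on a given [0, T].
   Dissipativity makes the distance of two solutions for the same noise nonincreasing, which gives
   uniqueness, the cocycle property and continuity in the initial value. Being a double limit of
   Picard iterates, the flow is jointly measurable: the coordinates of each iterate are
   parametrised Lebesgue integrals of measurable functions. *)

theory Submission
  imports Defs
begin

section \<open>Square-summable sequences\<close>

text \<open>The growth bound controls the drift only on balls, and dissipativity is a one-sided
  estimate, so a fixed-point argument does not apply to the drift itself. Local existence with
  continuation would bring in a lifetime depending on the path and the initial value; truncation
  keeps every approximation global and explicit, which is what joint measurability needs. The
  obstacle is that composing with the retraction need not preserve dissipativity, so truncated
  solutions cannot be compared with each other directly. What survives is an inequality against the
  noise path, because the retraction multiplies each vector by a positive factor at most 1. Every
  energy estimate is made for a difference from which the noise has dropped out, since noise paths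
  are continuous but not assumed differentiable.\<close>

lemma power2_norm_ell2: "(norm (x::ell2))\<^sup>2 = (\<Sum>\<^sub>\<infinity>i. (coord x i)\<^sup>2)"
  by (simp add: power2_norm_eq_inner inner_ell2_def flip: power2_eq_square)

lemma sum_coord_le_norm:
  assumes "finite F"
  shows "(\<Sum>i\<in>F. (coord x i)\<^sup>2) \<le> (norm x)\<^sup>2"
  unfolding power2_norm_ell2
  by (rule finite_sum_le_infsum) (use square_summable_coord[of x] assms in \<open>auto simp: square_summable_def\<close>)

lemma abs_coord_le_norm: "\<bar>coord x i\<bar> \<le> norm x"
  using sum_coord_le_norm[of "{i}" x] by (simp add: abs_le_square_iff[symmetric])

lemma bounded_linear_coord: "bounded_linear (\<lambda>x. coord x i)"
  by (rule bounded_linear_intro[of _ 1]) (auto simp: coord_simps abs_coord_le_norm)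

lemma square_summableI_bounded:
  assumes "\<And>F. finite F \<Longrightarrow> (\<Sum>i\<in>F. (x i)\<^sup>2) \<le> B"
  shows "square_summable x"
  unfolding square_summable_def
  by (rule nonneg_bdd_above_summable_on) (use assms in \<open>auto intro!: bdd_aboveI[of _ B]\<close>)

lemma norm_ell2_leI:
  assumes "\<And>F. finite F \<Longrightarrow> (\<Sum>i\<in>F. (coord x i)\<^sup>2) \<le> B\<^sup>2" "0 \<le> B"
  shows "norm x \<le> B"
proof -
  have "(norm x)\<^sup>2 \<le> B\<^sup>2"
    unfolding power2_norm_ell2
    by (rule infsum_le_finite_sums)
      (use assms square_summable_coord[of x] in \<open>auto simp: square_summable_def\<close>)
  then show ?thesis using assms(2) by (rule power2_le_imp_le)
qed

section \<open>Completeness of the sequence space\<close>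

instance ell2 :: complete_space
proof
  fix X :: "nat \<Rightarrow> ell2"
  assume X: "Cauchy X"
  have "convergent (\<lambda>n. coord (X n) i)" for i
    using bounded_linear.Cauchy[OF bounded_linear_coord X] by (rule real_Cauchy_convergent)
  then obtain y where y: "(\<lambda>n. coord (X n) i) \<longlonglongrightarrow> y i" for i
    using that[of "\<lambda>i. lim (\<lambda>n. coord (X n) i)"] by (simp add: convergent_LIMSEQ_iff)
  \<comment> \<open>On a finite index set the Cauchy estimate passes to the coordinatewise limit. As
    it is uniform over finite sets, it gives both that \<open>y\<close> lies in the space (after
    adding back one \<open>X M\<close>) and that the convergence is in norm.\<close>
  have tail: "\<exists>M. \<forall>n\<ge>M. \<forall>F. finite F \<longrightarrow> (\<Sum>i\<in>F. (y i - coord (X n) i)\<^sup>2) \<le> e\<^sup>2" if e: "e > 0" for e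
  proof -
    obtain M where M: "norm (X m - X n) < e" if "m \<ge> M" "n \<ge> M" for m n
      using CauchyD[OF X e] by blast
    have "(\<Sum>i\<in>F. (y i - coord (X n) i)\<^sup>2) \<le> e\<^sup>2" if n: "n \<ge> M" and F: "finite F" for n F
    proof (rule LIMSEQ_le_const2)
      show "(\<lambda>m. \<Sum>i\<in>F. (coord (X m) i - coord (X n) i)\<^sup>2) \<longlonglongrightarrow> (\<Sum>i\<in>F. (y i - coord (X n) i)\<^sup>2)"
        by (intro tendsto_intros y)
      have "(\<Sum>i\<in>F. (coord (X m) i - coord (X n) i)\<^sup>2) \<le> e\<^sup>2" if "m \<ge> M" for m
      proof -
        have "(\<Sum>i\<in>F. (coord (X m - X n) i)\<^sup>2) \<le> (norm (X m - X n))\<^sup>2"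
          using F by (rule sum_coord_le_norm)
        also have "\<dots> \<le> e\<^sup>2"
          using M[OF that n] by (intro power_mono) auto
        finally show ?thesis by (simp add: coord_diff)
      qed
      then show "\<exists>N. \<forall>m\<ge>N. (\<Sum>i\<in>F. (coord (X m) i - coord (X n) i)\<^sup>2) \<le> e\<^sup>2" by blast
    qed
    then show ?thesis by blast
  qed
  have "square_summable y"
  proof -
    obtain M where M: "\<And>F. finite F \<Longrightarrow> (\<Sum>i\<in>F. (y i - coord (X M) i)\<^sup>2) \<le> 1\<^sup>2"
      using tail[of 1] by auto
    have "square_summable (\<lambda>i. (y i - coord (X M) i) + coord (X M) i)"
      by (rule square_summable_add[OF square_summableI_bounded[OF M] square_summable_coord])
    then show ?thesis by simp
  qed
  then have Y: "coord (Abs_ell2 y) = y" by (rule coord_Abs_ell2)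
  have "X \<longlonglongrightarrow> Abs_ell2 y"
  proof (rule LIMSEQ_I)
    fix r :: real assume "r > 0"
    then obtain M where M: "\<forall>n\<ge>M. \<forall>F. finite F \<longrightarrow> (\<Sum>i\<in>F. (y i - coord (X n) i)\<^sup>2) \<le> (r/2)\<^sup>2"
      using tail[of "r/2"] by auto
    have "norm (X n - Abs_ell2 y) < r" if "n \<ge> M" for n
    proof -
      have "norm (Abs_ell2 y - X n) \<le> r/2"
        by (rule norm_ell2_leI) (use M that \<open>r > 0\<close> in \<open>auto simp: coord_diff Y\<close>)
      then show ?thesis using \<open>r > 0\<close> by (simp add: norm_minus_commute)
    qed
    then show "\<exists>no. \<forall>n\<ge>no. norm (X n - Abs_ell2 y) < r" by blast
  qed
  then show "convergent X" by (rule convergentI)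
qed

instance ell2 :: banach ..

section \<open>Expansion in unit sequences and measurability by coordinates\<close>

lemma coord_sum: "coord (\<Sum>i\<in>F. h i) j = (\<Sum>i\<in>F. coord (h i) j)"
  by (induction F rule: infinite_finite_induct) (auto simp: coord_simps)

lemma coord_partial_sum:
  assumes "finite F"
  shows "coord (\<Sum>i\<in>F. c i *\<^sub>R unit_seq i) j = (if j \<in> F then c j else 0)"
  using assms by (simp add: coord_sum coord_scaleR coord_unit_seq if_distrib sum.delta' cong: if_cong)

lemma has_sum_unit_seq: "((\<lambda>i. coord x i *\<^sub>R unit_seq i) has_sum x) UNIV"
proof -
  have s: "((\<lambda>i. (coord x i)\<^sup>2) has_sum (norm x)\<^sup>2) UNIV"
    unfolding power2_norm_ell2 using square_summable_coord[of x] unfolding square_summable_def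
    by (rule has_sum_infsum)
  \<comment> \<open>Pythagoras: the squared error of a finite partial sum is exactly the missing
    part of the series of squares, so summability of the squares becomes convergence in
    norm.\<close>
  have pyth: "(norm ((\<Sum>i\<in>F. coord x i *\<^sub>R unit_seq i) - x))\<^sup>2 = (norm x)\<^sup>2 - (\<Sum>i\<in>F. (coord x i)\<^sup>2)"
    if F: "finite F" for F
  proof -
    have "((\<lambda>i. (if i \<in> F then (coord x i)\<^sup>2 else 0)) has_sum (\<Sum>i\<in>F. (coord x i)\<^sup>2)) UNIV"
      using has_sum_finite[OF F, of "\<lambda>i. (coord x i)\<^sup>2"]
      by (rule has_sum_cong_neutral[THEN iffD1, rotated -1]) auto
    from has_sum_add[OF s has_sum_uminusI[OF this]]
    have "((\<lambda>i. (coord x i)\<^sup>2 - (if i \<in> F then (coord x i)\<^sup>2 else 0)) has_sum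
        ((norm x)\<^sup>2 - (\<Sum>i\<in>F. (coord x i)\<^sup>2))) UNIV"
      by simp
    moreover have "(coord x i)\<^sup>2 - (if i \<in> F then (coord x i)\<^sup>2 else 0) =
        (coord ((\<Sum>i\<in>F. coord x i *\<^sub>R unit_seq i) - x) i)\<^sup>2" for i
      by (simp add: coord_diff coord_partial_sum[OF F])
    ultimately show ?thesis
      unfolding power2_norm_ell2[of "_ - x"] by (simp add: infsumI)
  qed
  have "((\<lambda>F. (norm x)\<^sup>2 - (\<Sum>i\<in>F. (coord x i)\<^sup>2)) \<longlongrightarrow> (norm x)\<^sup>2 - (norm x)\<^sup>2) (finite_subsets_at_top UNIV)"
    using s unfolding has_sum_def by (intro tendsto_intros)
  then have "((\<lambda>F. sqrt ((norm x)\<^sup>2 - (\<Sum>i\<in>F. (coord x i)\<^sup>2))) \<longlongrightarrow> sqrt 0) (finite_subsets_at_top UNIV)"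
    by (intro tendsto_real_sqrt) simp
  moreover have "\<forall>\<^sub>F F in finite_subsets_at_top UNIV. sqrt ((norm x)\<^sup>2 - (\<Sum>i\<in>F. (coord x i)\<^sup>2)) =
      norm ((\<Sum>i\<in>F. coord x i *\<^sub>R unit_seq i) - x)"
    by (rule eventually_finite_subsets_at_top_weakI) (simp flip: pyth)
  ultimately have "((\<lambda>F. norm ((\<Sum>i\<in>F. coord x i *\<^sub>R unit_seq i) - x)) \<longlongrightarrow> 0) (finite_subsets_at_top UNIV)"
    by (simp add: tendsto_cong)
  then show ?thesis
    unfolding has_sum_def by (simp add: LIM_zero_iff tendsto_norm_zero_iff)
qed

text \<open>Measurability is preserved by limits of sequences, so the net of finite sets is replaced
  by the exhausting sequence of symmetric intervals.\<close>

lemma LIMSEQ_partial_sums: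
  "(\<lambda>n. \<Sum>i\<in>{- int n..int n}. coord x i *\<^sub>R unit_seq i) \<longlonglongrightarrow> x"
proof (rule filterlim_compose[OF has_sum_unit_seq[unfolded has_sum_def]])
  show "filterlim (\<lambda>n. {- int n..int n}) (finite_subsets_at_top UNIV) sequentially"
    unfolding filterlim_finite_subsets_at_top
  proof (intro allI impI)
    fix X :: "int set" assume X: "finite X \<and> X \<subseteq> UNIV"
    then obtain N where N: "\<bar>i\<bar> \<le> int N" if "i \<in> X" for i
    proof -
      have "\<bar>i\<bar> \<le> int (nat (\<Sum>j\<in>X. \<bar>j\<bar>))" if "i \<in> X" for i
        using member_le_sum[of i X abs] X that by auto
      then show thesis using that by blast
    qed
    have "finite {- int n..int n} \<and> X \<subseteq> {- int n..int n} \<and> {- int n..int n} \<subseteq> UNIV" if "n \<ge> N" for n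
      using N that by fastforce
    then show "\<forall>\<^sub>F n in sequentially. finite {- int n..int n} \<and> X \<subseteq> {- int n..int n} \<and> {- int n..int n} \<subseteq> UNIV"
      unfolding eventually_sequentially by blast
  qed
qed

text \<open>Passing through the product space of all sequences avoids sums of measurable functions
  with values in \<open>ell2\<close>, which would need a second countable topology.\<close>

lemma borel_measurable_ell2I:
  assumes "\<And>i. (\<lambda>w. coord (h w) i) \<in> borel_measurable M"
  shows "h \<in> borel_measurable M"
proof (rule borel_measurable_LIMSEQ_metric)
  fix n
  have c: "(\<lambda>w. coord (h w)) \<in> borel_measurable M"
    by (rule measurable_coordinatewise_then_product) (rule assms)
  have "continuous_on UNIV (\<lambda>v::int \<Rightarrow> real. \<Sum>i\<in>{- int n..int n}. v i *\<^sub>R unit_seq i)"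
    by (intro continuous_intros continuous_on_product_coordinates)
  from measurable_compose[OF c borel_measurable_continuous_onI[OF this]]
  show "(\<lambda>w. \<Sum>i\<in>{- int n..int n}. coord (h w) i *\<^sub>R unit_seq i) \<in> borel_measurable M" .
qed (rule LIMSEQ_partial_sums)

lemma borel_measurable_coord [measurable]: "(\<lambda>x. coord x i) \<in> borel_measurable borel"
  by (intro borel_measurable_continuous_onI linear_continuous_on bounded_linear_coord)

text \<open>The lattice operator is twice the identity minus two shifts. Shifts being isometries,
  both the norm bound 4 and, by Cauchy-Schwarz, the nonnegativity of the operator follow.\<close>

definition shift_ell2 :: "int \<Rightarrow> ell2 \<Rightarrow> ell2"
  where "shift_ell2 k x = Abs_ell2 (\<lambda>i. coord x (i + k))"

lemma coord_shift_ell2: "coord (shift_ell2 k x) i = coord x (i + k)"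
  by (simp add: shift_ell2_def coord_Abs_ell2 square_summable_shift)

lemma norm_shift_ell2: "norm (shift_ell2 k x) = norm x"
proof -
  have "bij_betw (\<lambda>i::int. i + k) UNIV UNIV"
    by (rule bij_betwI[where g="\<lambda>i. i - k"]) auto
  from infsum_reindex_bij_betw[OF this, of "\<lambda>i. (coord x i)\<^sup>2"]
  have "(norm (shift_ell2 k x))\<^sup>2 = (norm x)\<^sup>2"
    by (simp add: power2_norm_ell2 coord_shift_ell2)
  then show ?thesis by (simp add: power2_eq_iff_nonneg)
qed

lemma lattice_op_eq: "lattice_op x = 2 *\<^sub>R x - shift_ell2 (-1) x - shift_ell2 1 x"
  by (rule ell2_eqI) (simp add: coord_simps coord_lattice_op coord_shift_ell2)

lemma lattice_op_diff: "lattice_op (x - y) = lattice_op x - lattice_op y"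
  by (rule ell2_eqI) (simp add: coord_simps coord_lattice_op)

lemma norm_lattice_op: "norm (lattice_op x) \<le> 4 * norm x"
  unfolding lattice_op_eq
  using norm_triangle_ineq4[of "2 *\<^sub>R x - shift_ell2 (-1) x" "shift_ell2 1 x"]
    norm_triangle_ineq4[of "2 *\<^sub>R x" "shift_ell2 (-1) x"]
  by (simp add: norm_shift_ell2)

lemma lattice_op_nonneg: "0 \<le> x \<bullet> lattice_op x"
proof -
  have "x \<bullet> shift_ell2 k x \<le> x \<bullet> x" for k
    using norm_cauchy_schwarz[of x "shift_ell2 k x"]
    by (simp add: norm_shift_ell2 power2_norm_eq_inner[symmetric] power2_eq_square)
  from this[of 1] this[of "-1"] show ?thesis
    by (simp add: lattice_op_eq inner_diff_right)
qed

section \<open>Dissipative integral equations\<close>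

text \<open>A finite horizon is built in because a truncated solution solves the original equation
  only up to some time. Integrability is not demanded: it follows from continuity of
  \<open>u\<close> when \<open>G\<close> is continuous.\<close>

definition solution_on ::
    "('a::banach \<Rightarrow> 'a) \<Rightarrow> (real \<Rightarrow> 'a) \<Rightarrow> 'a \<Rightarrow> real \<Rightarrow> (real \<Rightarrow> 'a) \<Rightarrow> bool"
  where "solution_on G w x T u \<longleftrightarrow> continuous_on {0..T} u \<and>
    (\<forall>t\<in>{0..T}. u t = x + integral {0..t} (\<lambda>s. G (u s)) + w t)"

section \<open>Picard iteration for globally Lipschitz fields\<close>

primrec picard :: "('a::banach \<Rightarrow> 'a) \<Rightarrow> (real \<Rightarrow> 'a) \<Rightarrow> 'a \<Rightarrow> nat \<Rightarrow> real \<Rightarrow> 'a"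
  where
    "picard G w x 0 = (\<lambda>t. x)"
  | "picard G w x (Suc n) = (\<lambda>t. x + integral {0..t} (\<lambda>s. G (picard G w x n s)) + w t)"

lemma continuous_on_picard:
  assumes "continuous_on UNIV G" "continuous_on {0..T} w"
  shows "continuous_on {0..T} (picard G w x n)"
proof (induction n)
  case (Suc n)
  have "continuous_on {0..T} (\<lambda>s. G (picard G w x n s))"
    by (rule continuous_on_compose2[OF assms(1) Suc]) auto
  then have "continuous_on {0..T} (\<lambda>t. integral {0..t} (\<lambda>s. G (picard G w x n s)))"
    by (intro indefinite_integral_continuous_1 integrable_continuous_real)
  then show ?case by (auto intro!: continuous_intros assms(2))
qed simp

lemma continuous_on_atLeastI:
  assumes "\<And>T::real. continuous_on {a..T} h"
  shows "continuous_on {a..} h"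
  unfolding continuous_on_eq_continuous_within
proof
  fix t assume t: "t \<in> {a..}"
  have "at t within {a..} = at t within {a..t + 1}"
    by (rule at_within_nhd[of t "{..<t + 1}"]) auto
  moreover have "continuous (at t within {a..t + 1}) h"
    using assms[of "t + 1"] t by (simp add: continuous_on_eq_continuous_within)
  ultimately show "continuous (at t within {a..}) h"
    by (simp add: continuous_within)
qed

text \<open>The weight \<open>exp (2 * \<Lambda> * t)\<close> reproduces itself under integration:
  \<Lambda> times its integral is at most half of it. So each iteration gains a factor 1/2 on the
  whole interval, however long it is.\<close>

lemma picard_diff_bound:
  assumes G: "\<Lambda>-lipschitz_on UNIV G" and w: "continuous_on {0..T} w"
  obtains C where "\<And>n t. t \<in> {0..T} \<Longrightarrow>
    norm (picard G w x (Suc n) t - picard G w x n t) \<le> C * exp (2 * \<Lambda> * t) * (1/2)^n"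
proof -
  have cG: "continuous_on UNIV G" using G by (rule lipschitz_on_continuous_on)
  have \<Lambda>: "0 \<le> \<Lambda>" using G by (rule lipschitz_on_nonneg)
  note cp = continuous_on_picard[OF cG w, of x]
  have "continuous_on {0..T} (\<lambda>t. picard G w x (Suc 0) t - picard G w x 0 t)"
    by (intro continuous_on_diff cp)
  then have "bounded ((\<lambda>t. picard G w x (Suc 0) t - picard G w x 0 t) ` {0..T})"
    by (intro compact_imp_bounded compact_continuous_image) auto
  then obtain C where "0 < C" and C: "\<And>t. t \<in> {0..T} \<Longrightarrow> norm (picard G w x (Suc 0) t - picard G w x 0 t) \<le> C"
    unfolding bounded_pos by (auto simp del: picard.simps)
  have "\<forall>t\<in>{0..T}. norm (picard G w x (Suc n) t - picard G w x n t) \<le> C * exp (2 * \<Lambda> * t) * (1/2)^n" for n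
  proof (induction n)
    case 0
    have "C \<le> C * exp (2 * \<Lambda> * t)" if "t \<in> {0..T}" for t
      using that \<Lambda> \<open>0 < C\<close> by simp
    then show ?case using C by (force simp del: picard.simps)
  next
    case (Suc n)
    show ?case
    proof
      fix t assume t: "t \<in> {0..T}"
      let ?p = "picard G w x"
      have c: "continuous_on {0..t} (\<lambda>s. G (?p k s))" for k
        by (rule continuous_on_compose2[OF cG continuous_on_subset[OF cp]]) (use t in auto)
      have "?p (Suc (Suc n)) t - ?p (Suc n) t = integral {0..t} (\<lambda>s. G (?p (Suc n) s)) - integral {0..t} (\<lambda>s. G (?p n s))"
        by simp
      also have "\<dots> = integral {0..t} (\<lambda>s. G (?p (Suc n) s) - G (?p n s))"
        by (rule integral_diff[symmetric]; rule integrable_continuous_real[OF c])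
      finally have eq: "?p (Suc (Suc n)) t - ?p (Suc n) t = \<dots>" .
      have hi: "((\<lambda>s. \<Lambda> * (C * exp (2 * \<Lambda> * s) * (1/2)^n)) has_integral
          (C * exp (2 * \<Lambda> * t) * (1/2)^Suc n - C * exp (2 * \<Lambda> * 0) * (1/2)^Suc n)) {0..t}"
        by (rule fundamental_theorem_of_calculus)
          (use t in \<open>auto intro!: derivative_eq_intros simp flip: has_real_derivative_iff_has_vector_derivative\<close>)
      have hb: "norm (G (?p (Suc n) s) - G (?p n s)) \<le> \<Lambda> * (C * exp (2 * \<Lambda> * s) * (1/2)^n)" if "s \<in> {0..t}" for s
      proof -
        have "norm (G (?p (Suc n) s) - G (?p n s)) \<le> \<Lambda> * norm (?p (Suc n) s - ?p n s)"
          using lipschitz_onD[OF G, of "?p (Suc n) s" "?p n s"] unfolding dist_norm by blast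
        also have "\<dots> \<le> \<Lambda> * (C * exp (2 * \<Lambda> * s) * (1/2)^n)"
          using Suc that t \<Lambda> by (intro mult_left_mono) auto
        finally show ?thesis .
      qed
      have "norm (integral {0..t} (\<lambda>s. G (?p (Suc n) s) - G (?p n s))) \<le>
          integral {0..t} (\<lambda>s. \<Lambda> * (C * exp (2 * \<Lambda> * s) * (1/2)^n))"
        by (rule integral_norm_bound_integral[OF integrable_continuous_real[OF continuous_on_diff[OF c c]]
              has_integral_integrable[OF hi] hb])
      also have "\<dots> = C * exp (2 * \<Lambda> * t) * (1/2)^Suc n - C * exp (2 * \<Lambda> * 0) * (1/2)^Suc n"
        using hi by (rule integral_unique)
      finally have "norm (integral {0..t} (\<lambda>s. G (?p (Suc n) s) - G (?p n s))) \<le>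
          C * exp (2 * \<Lambda> * t) * (1/2)^Suc n - C * exp (2 * \<Lambda> * 0) * (1/2)^Suc n" .
      then show "norm (?p (Suc (Suc n)) t - ?p (Suc n) t) \<le> C * exp (2 * \<Lambda> * t) * (1/2)^Suc n"
        unfolding eq by (rule order_trans) (use \<open>0 < C\<close> in simp)
    qed
  qed
  then show thesis using that by blast
qed

lemma picard_converges:
  fixes G :: "'a::banach \<Rightarrow> 'a" and x :: 'a
  assumes G: "\<Lambda>-lipschitz_on UNIV G" and w: "continuous_on {0..} w"
  defines "u \<equiv> \<lambda>t. lim (\<lambda>n. picard G w x n t)"
  shows "\<And>t. 0 \<le> t \<Longrightarrow> (\<lambda>n. picard G w x n t) \<longlonglongrightarrow> u t"
    and "solution_on G w x T u"
proof -
  let ?p = "picard G w x"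
  have cG: "continuous_on UNIV G" using G by (rule lipschitz_on_continuous_on)
  have \<Lambda>: "0 \<le> \<Lambda>" using G by (rule lipschitz_on_nonneg)
  have w': "continuous_on {0..T} w" for T
    using w by (rule continuous_on_subset) auto
  \<comment> \<open>The same limit as a telescoping series, the form to which the Weierstrass test
    applies.\<close>
  define v where "v t = x + (\<Sum>n. ?p (Suc n) t - ?p n t)" for t
  have unif: "uniform_limit {0..T} ?p v sequentially" for T
  proof -
    obtain C where C: "\<And>n t. t \<in> {0..T} \<Longrightarrow> norm (?p (Suc n) t - ?p n t) \<le> C * exp (2 * \<Lambda> * t) * (1/2)^n"
      using picard_diff_bound[OF G w'] by metis
    have "uniform_limit {0..T} (\<lambda>n t. \<Sum>k<n. ?p (Suc k) t - ?p k t) (\<lambda>t. \<Sum>n. ?p (Suc n) t - ?p n t) sequentially"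
    proof (rule Weierstrass_m_test)
      fix n t assume t: "t \<in> {0..T}"
      \<comment> \<open>The sign of \<open>C\<close> is recovered from the bound itself, which for n
        = 0 dominates a norm.\<close>
      have "0 \<le> C" using order_trans[OF norm_ge_zero C[OF t, of 0]]
        by (simp add: zero_le_mult_iff)
      then have "C * exp (2 * \<Lambda> * t) * (1/2)^n \<le> C * exp (2 * \<Lambda> * T) * (1/2)^n"
        using t \<Lambda> by (intro mult_right_mono mult_left_mono) (auto simp: mult_left_mono)
      with C[OF t, of n] show "norm (?p (Suc n) t - ?p n t) \<le> C * exp (2 * \<Lambda> * T) * (1/2)^n"
        by linarith
    qed (intro summable_mult summable_geometric, simp)
    moreover have "(\<Sum>k<n. ?p (Suc k) t - ?p k t) = ?p n t - x" for n t
      using sum_lessThan_telescope[of "\<lambda>k. ?p k t" n] by simp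
    ultimately have "uniform_limit {0..T} (\<lambda>n t. ?p n t - x) (\<lambda>t. \<Sum>n. ?p (Suc n) t - ?p n t) sequentially"
      by simp
    from uniform_limit_add[OF uniform_limit_const[of "\<lambda>_. x"] this]
    have "uniform_limit {0..T} (\<lambda>n t. x + (?p n t - x)) v sequentially"
      unfolding v_def .
    then show ?thesis by simp
  qed
  have lim: "(\<lambda>n. ?p n t) \<longlonglongrightarrow> v t" if "0 \<le> t" for t
    using tendsto_uniform_limitI[OF unif[of t], of t] that by simp
  then have uv: "u t = v t" if "0 \<le> t" for t
    using that by (simp add: u_def limI)
  show "(\<lambda>n. ?p n t) \<longlonglongrightarrow> u t" if "0 \<le> t" for t
    using lim uv that by simp
  have cp: "continuous_on {0..T} (?p n)" for n T
    by (rule continuous_on_picard[OF cG w'])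
  have "continuous_on {0..T} v"
    by (rule uniform_limit_theorem[OF _ unif]) (auto simp: cp)
  moreover have "v t = x + integral {0..t} (\<lambda>s. G (v s)) + w t" if t: "t \<in> {0..T}" for t
  proof -
    have "uniform_limit {0..t} (\<lambda>n s. G (?p n s)) (\<lambda>s. G (v s)) sequentially"
    proof (rule uniform_limitI)
      fix e :: real assume "0 < e"
      \<comment> \<open>The summand 1 covers the case \<Lambda> = 0.\<close>
      then have "0 < e / (\<Lambda> + 1)" using \<Lambda> by simp
      from uniform_limitD[OF unif this, of t]
      show "\<forall>\<^sub>F n in sequentially. \<forall>s\<in>{0..t}. dist (G (?p n s)) (G (v s)) < e"
      proof (eventually_elim, intro ballI)
        fix n s assume *: "\<forall>s\<in>{0..t}. dist (?p n s) (v s) < e / (\<Lambda> + 1)" and "s \<in> {0..t}"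
        then have "\<Lambda> * dist (?p n s) (v s) \<le> \<Lambda> * (e / (\<Lambda> + 1))"
          using \<Lambda> by (intro mult_left_mono) (auto intro: less_imp_le)
        also have "\<dots> < e" using \<Lambda> \<open>0 < e\<close> by (simp add: field_simps)
        finally show "dist (G (?p n s)) (G (v s)) < e"
          using lipschitz_onD[OF G, of "?p n s" "v s"] by simp
      qed
    qed
    then obtain I J where I: "\<And>n. ((\<lambda>s. G (?p n s)) has_integral I n) {0..t}"
      and J: "((\<lambda>s. G (v s)) has_integral J) {0..t}" and IJ: "I \<longlonglongrightarrow> J"
    proof (rule uniform_limit_integral)
      show "continuous_on {0..t} (\<lambda>s. G (?p n s))" for n
        by (rule continuous_on_compose2[OF cG cp]) auto
    qed auto
    have "(\<lambda>n. x + I n + w t) \<longlonglongrightarrow> x + J + w t"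
      by (intro tendsto_intros IJ)
    moreover have "x + I n + w t = ?p (Suc n) t" for n
      using I[of n] by (simp add: integral_unique)
    ultimately have "(\<lambda>n. ?p (Suc n) t) \<longlonglongrightarrow> x + integral {0..t} (\<lambda>s. G (v s)) + w t"
      using J by (simp add: integral_unique)
    moreover have "(\<lambda>n. ?p (Suc n) t) \<longlonglongrightarrow> v t"
      using lim[of t] t by (intro LIMSEQ_Suc) auto
    ultimately show ?thesis by (rule LIMSEQ_unique[rotated])
  qed
  ultimately have "solution_on G w x T v" by (simp add: solution_on_def)
  moreover have "integral {0..t} (\<lambda>s. G (u s)) = integral {0..t} (\<lambda>s. G (v s))" for t
    by (rule integral_cong) (simp add: uv)
  moreover have "continuous_on {0..T} u \<longleftrightarrow> continuous_on {0..T} v"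
    by (rule continuous_on_cong) (auto simp: uv)
  ultimately show "solution_on G w x T u"
    by (simp add: solution_on_def uv)
qed

section \<open>Truncation by the radial retraction\<close>

definition ball_retraction :: "real \<Rightarrow> 'a::real_normed_vector \<Rightarrow> 'a"
  where "ball_retraction R x = (R / max R (norm x)) *\<^sub>R x"

lemma ball_retraction_id: "0 < R \<Longrightarrow> norm x \<le> R \<Longrightarrow> ball_retraction R x = x"
  by (simp add: ball_retraction_def max_absorb1)

lemma ball_retraction_in_cball: "0 < R \<Longrightarrow> ball_retraction R x \<in> cball 0 R"
  by (auto simp: ball_retraction_def max_def field_simps)

text \<open>The constant 2 is a sum of two contributions of size 1: moving the vector with the
  scaling factor fixed, and changing the factor, where \<open>max R (norm x)\<close> is 1-Lipschitz
  in x. This works in every normed space.\<close>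

lemma lipschitz_on_ball_retraction:
  assumes R: "0 < R"
  shows "2-lipschitz_on UNIV (ball_retraction R)"
proof (rule lipschitz_onI)
  fix x y :: 'a
  define a b where "a = max R (norm x)" and "b = max R (norm y)"
  have ab: "0 < a" "0 < b" "R \<le> a" "norm y \<le> b" using R by (auto simp: a_def b_def)
  have "ball_retraction R x - ball_retraction R y = (R/a) *\<^sub>R (x - y) + (R/a - R/b) *\<^sub>R y"
    by (simp add: ball_retraction_def a_def b_def algebra_simps)
  then have "norm (ball_retraction R x - ball_retraction R y) \<le>
      norm ((R/a) *\<^sub>R (x - y)) + norm ((R/a - R/b) *\<^sub>R y)"
    by (simp only: norm_triangle_ineq)
  also have "norm ((R/a) *\<^sub>R (x - y)) = (R/a) * norm (x - y)"
    using R ab by simp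
  also have "\<dots> \<le> norm (x - y)"
    using R ab by (intro mult_left_le_one_le) (auto simp: field_simps)
  also have "norm ((R/a - R/b) *\<^sub>R y) = (R/a) * (norm y / b) * \<bar>b - a\<bar>"
  proof -
    have "R/a - R/b = (R/a) * (b - a) / b" using ab by (simp add: field_simps)
    then show ?thesis using R ab by (simp add: abs_mult)
  qed
  also have "\<dots> \<le> 1 * 1 * \<bar>b - a\<bar>"
    using R ab by (intro mult_mono mult_right_mono) (auto simp: field_simps)
  also have "\<dots> \<le> norm (x - y)"
    unfolding a_def b_def using norm_triangle_ineq2[of x y] norm_triangle_ineq2[of y x]
    by (auto simp: max_def norm_minus_commute)
  finally show "dist (ball_retraction R x) (ball_retraction R y) \<le> 2 * dist x y"
    by (simp add: dist_norm)
qed simp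

section \<open>Energy estimates\<close>

lemma has_real_derivative_norm_power2:
  fixes d :: "real \<Rightarrow> 'a::real_inner"
  assumes "(d has_vector_derivative D) (at t)"
  shows "((\<lambda>s. (norm (d s))\<^sup>2) has_real_derivative 2 * (d t \<bullet> D)) (at t)"
proof -
  have "((\<lambda>s. d s \<bullet> d s) has_derivative (\<lambda>h. d t \<bullet> (h *\<^sub>R D) + (h *\<^sub>R D) \<bullet> d t)) (at t)"
    using assms unfolding has_vector_derivative_def by (intro has_derivative_inner)
  then show ?thesis
    unfolding has_field_derivative_def power2_norm_eq_inner
    by (rule has_derivative_eq_rhs) (simp add: fun_eq_iff inner_commute)
qed

text \<open>With a merely continuous \<open>w\<close> the solution itself need not be
  differentiable. Subtracting \<open>w\<close> leaves x plus an integral of a continuous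
  function.\<close>

lemma solution_on_has_vector_derivative:
  assumes u: "solution_on G w x T u" and G: "continuous_on UNIV G" and t: "0 < t" "t < T"
  shows "((\<lambda>s. u s - w s) has_vector_derivative G (u t)) (at t)"
proof -
  have c: "continuous_on {0..T} (\<lambda>s. G (u s))"
    by (rule continuous_on_compose2[OF G]) (use u in \<open>auto simp: solution_on_def\<close>)
  have "((\<lambda>s. integral {0..s} (\<lambda>s. G (u s))) has_vector_derivative G (u t)) (at t within {0..T})"
    by (rule integral_has_vector_derivative[OF c]) (use t in auto)
  moreover have "at t within {0..T} = at t"
    using t by (intro at_within_interior) simp
  ultimately have "((\<lambda>s. x + integral {0..s} (\<lambda>s. G (u s))) has_vector_derivative G (u t)) (at t)"
    by (auto intro!: derivative_eq_intros)
  then show ?thesis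
    by (rule has_vector_derivative_transform_within_open[of _ _ _ "{0<..<T}"])
      (use t u in \<open>auto simp: solution_on_def\<close>)
qed

text \<open>The common noise cancels in u - v, so the derivative of its squared norm is twice the
  inner product of u - v with G u - G v, which dissipativity makes nonpositive. The case x = y is
  uniqueness.\<close>

lemma dissipative_comparison:
  fixes G :: "'a::{real_inner,banach} \<Rightarrow> 'a"
  assumes G: "continuous_on UNIV G" "\<And>x y. (x - y) \<bullet> (G x - G y) \<le> 0"
    and u: "solution_on G w x T u" and v: "solution_on G w y T v" and t: "t \<in> {0..T}"
  shows "norm (u t - v t) \<le> norm (x - y)"
proof -
  have "(norm (u t - v t))\<^sup>2 \<le> (norm (u 0 - v 0))\<^sup>2"
  proof (rule DERIV_nonpos_imp_decreasing_open[of 0 t "\<lambda>s. (norm (u s - v s))\<^sup>2"])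
    show "continuous_on {0..t} (\<lambda>s. (norm (u s - v s))\<^sup>2)"
      using u v t unfolding solution_on_def
      by (auto intro!: continuous_intros elim: continuous_on_subset)
    fix s assume s: "0 < s" "s < t"
    have "((\<lambda>s. (u s - w s) - (v s - w s)) has_vector_derivative G (u s) - G (v s)) (at s)"
      using s t by (intro has_vector_derivative_diff solution_on_has_vector_derivative[OF u G(1)]
        solution_on_has_vector_derivative[OF v G(1)]) auto
    then have "((\<lambda>s. u s - v s) has_vector_derivative G (u s) - G (v s)) (at s)" by simp
    from has_real_derivative_norm_power2[OF this] G(2)[of "u s" "v s"]
    show "\<exists>d. ((\<lambda>s. (norm (u s - v s))\<^sup>2) has_real_derivative d) (at s) \<and> d \<le> 0"
      by fastforce
  qed (use t in auto)
  moreover have "u 0 - v 0 = x - y"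
    using u v t by (auto simp: solution_on_def)
  ultimately show ?thesis by (metis norm_ge_zero power2_le_imp_le)
qed

text \<open>Rescaling the argument of \<open>G\<close> by a positive factor \<open>c u\<close> keeps enough of the
  dissipativity: \<open>\<langle>u - w, G(c u)\<rangle> \<le> \<langle>u - w, G(c w)\<rangle>\<close>, and \<open>c w\<close> stays bounded.
  So the bound does not depend on the truncation.\<close>

lemma truncated_a_priori_bound:
  fixes G :: "'a::{real_inner,banach} \<Rightarrow> 'a"
  assumes G: "continuous_on UNIV G" "\<And>x y. (x - y) \<bullet> (G x - G y) \<le> 0" and R: "0 < R"
    and w: "continuous_on {0..T} w" "\<And>s. s \<in> {0..T} \<Longrightarrow> norm (w s) \<le> M"
    and C: "\<And>y. norm y \<le> M \<Longrightarrow> norm (G y) \<le> C"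
    and u: "solution_on (G \<circ> ball_retraction R) w x T u" and t: "t \<in> {0..T}"
  shows "(norm (u t - w t))\<^sup>2 \<le> exp t * ((norm x)\<^sup>2 + C\<^sup>2)"
proof -
  define v where "v s = u s - w s" for s
  have cG: "continuous_on UNIV (G \<circ> ball_retraction R)"
    using lipschitz_on_continuous_on[OF lipschitz_on_ball_retraction[OF R]] G(1)
    by (intro continuous_on_compose) (auto elim: continuous_on_subset)
  have bound: "v s \<bullet> G (ball_retraction R (u s)) \<le> norm (v s) * C" if s: "s \<in> {0..T}" for s
  proof -
    \<comment> \<open>The factor applied to \<open>u s\<close> is also applied to
      \<open>w s\<close>, although it is not the retraction factor of \<open>w s\<close>: only then
      is the difference of the arguments a multiple of \<open>v s\<close>.\<close>
    define c where "c = R / max R (norm (u s))"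
    have c: "0 < c" "c \<le> 1" using R by (auto simp: c_def)
    have "(c *\<^sub>R u s - c *\<^sub>R w s) \<bullet> (G (c *\<^sub>R u s) - G (c *\<^sub>R w s)) \<le> 0" by (rule G(2))
    then have "c * (v s \<bullet> (G (c *\<^sub>R u s) - G (c *\<^sub>R w s))) \<le> 0"
      by (simp add: v_def flip: scaleR_diff_right)
    then have "v s \<bullet> (G (c *\<^sub>R u s) - G (c *\<^sub>R w s)) \<le> 0"
      using c by (simp add: mult_le_0_iff)
    then have "v s \<bullet> G (c *\<^sub>R u s) \<le> v s \<bullet> G (c *\<^sub>R w s)"
      by (simp add: inner_diff_right)
    also have "\<dots> \<le> norm (v s) * norm (G (c *\<^sub>R w s))"
      by (rule norm_cauchy_schwarz)
    also have "\<dots> \<le> norm (v s) * C"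
    proof (intro mult_left_mono C)
      have "c * norm (w s) \<le> norm (w s)" using c by (intro mult_left_le_one_le) auto
      then show "norm (c *\<^sub>R w s) \<le> M" using w(2)[OF s] c by simp
    qed simp
    finally show ?thesis by (simp add: ball_retraction_def c_def)
  qed
  \<comment> \<open>Gronwall with an integrating factor: 2 |v| C is at most |v|^2 + C^2, so |v|^2 +
    C^2 grows at most like its own exponential.\<close>
  have "exp (-t) * ((norm (v t))\<^sup>2 + C\<^sup>2) \<le> exp (-0) * ((norm (v 0))\<^sup>2 + C\<^sup>2)"
  proof (rule DERIV_nonpos_imp_decreasing_open[of 0 t "\<lambda>s. exp (-s) * ((norm (v s))\<^sup>2 + C\<^sup>2)"])
    show "continuous_on {0..t} (\<lambda>s. exp (-s) * ((norm (v s))\<^sup>2 + C\<^sup>2))"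
      using u w(1) t unfolding solution_on_def v_def
      by (auto intro!: continuous_intros elim: continuous_on_subset)
    fix s assume s: "0 < s" "s < t"
    have "(v has_vector_derivative G (ball_retraction R (u s))) (at s)"
      unfolding v_def using solution_on_has_vector_derivative[OF u cG, of s] s t by simp
    note this [THEN has_real_derivative_norm_power2, derivative_intros]
    have "((\<lambda>s. exp (-s) * ((norm (v s))\<^sup>2 + C\<^sup>2)) has_real_derivative
        exp (-s) * (2 * (v s \<bullet> G (ball_retraction R (u s))) - ((norm (v s))\<^sup>2 + C\<^sup>2))) (at s)"
      by (auto intro!: derivative_eq_intros simp: algebra_simps)
    moreover have "2 * (v s \<bullet> G (ball_retraction R (u s))) \<le> (norm (v s))\<^sup>2 + C\<^sup>2"
      using bound[of s] s t zero_le_power2[of "norm (v s) - C"] by (simp add: power2_diff)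
    ultimately show "\<exists>d. ((\<lambda>s. exp (-s) * ((norm (v s))\<^sup>2 + C\<^sup>2)) has_real_derivative d) (at s) \<and> d \<le> 0"
      by (intro exI conjI) (auto simp: mult_le_0_iff)
  qed (use t in auto)
  moreover have "v 0 = x" using u t by (auto simp: solution_on_def v_def)
  ultimately have "exp t * (exp (-t) * ((norm (v t))\<^sup>2 + C\<^sup>2)) \<le> exp t * ((norm x)\<^sup>2 + C\<^sup>2)"
    by (intro mult_left_mono) auto
  then have "(norm (v t))\<^sup>2 + C\<^sup>2 \<le> exp t * ((norm x)\<^sup>2 + C\<^sup>2)"
    by (simp only: mult.assoc[symmetric] exp_minus_inverse mult_1)
  then show ?thesis unfolding v_def using zero_le_power2[of C] by linarith
qed

section \<open>The flow of a dissipative field along a continuous path\<close>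

locale dissipative_field =
  fixes G :: "'a::{real_inner,banach} \<Rightarrow> 'a"
  assumes lipschitz_on_balls: "\<And>R. \<exists>\<Lambda>. \<Lambda>-lipschitz_on (cball 0 R) G"
    and dissipative: "\<And>x y. (x - y) \<bullet> (G x - G y) \<le> 0"
begin

text \<open>The radius \<open>Suc N\<close> is positive even for N = 0.\<close>

definition truncated :: "nat \<Rightarrow> 'a \<Rightarrow> 'a"
  where "truncated N = G \<circ> ball_retraction (real (Suc N))"

definition truncated_flow :: "(real \<Rightarrow> 'a) \<Rightarrow> 'a \<Rightarrow> nat \<Rightarrow> real \<Rightarrow> 'a"
  where "truncated_flow w x N t = lim (\<lambda>n. picard (truncated N) w x n t)"

text \<open>The flow is an explicit pointwise limit rather than a chosen solution, so that
  measurability in all arguments can be inherited from the approximations.\<close>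

definition flow :: "(real \<Rightarrow> 'a) \<Rightarrow> 'a \<Rightarrow> real \<Rightarrow> 'a"
  where "flow w x t = lim (\<lambda>N. truncated_flow w x N t)"

lemma continuous: "continuous_on UNIV G"
  unfolding continuous_on_eq_continuous_at[OF open_UNIV]
proof
  fix x :: 'a
  obtain \<Lambda> where "\<Lambda>-lipschitz_on (cball 0 (norm x + 1)) G"
    using lipschitz_on_balls by blast
  then have "continuous_on (ball 0 (norm x + 1)) G"
    by (rule continuous_on_subset[OF lipschitz_on_continuous_on ball_subset_cball])
  then show "isCont G x"
    by (rule continuous_on_interior) (simp add: interior_open)
qed

lemma lipschitz_on_truncated: "\<exists>\<Lambda>. \<Lambda>-lipschitz_on UNIV (truncated N)"
proof -
  obtain \<Lambda> where "\<Lambda>-lipschitz_on (cball 0 (real (Suc N))) G"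
    using lipschitz_on_balls by blast
  then have "\<Lambda>-lipschitz_on (ball_retraction (real (Suc N)) ` UNIV) G"
    by (rule lipschitz_on_subset) (rule image_subsetI, rule ball_retraction_in_cball, simp)
  from lipschitz_on_compose[OF lipschitz_on_ball_retraction this] show ?thesis
    unfolding truncated_def by auto
qed

lemma continuous_on_truncated: "continuous_on UNIV (truncated N)"
  using lipschitz_on_truncated lipschitz_on_continuous_on by blast

context
  fixes w :: "real \<Rightarrow> 'a"
  assumes w: "continuous_on {0..} w"
begin

lemma picard_LIMSEQ_truncated_flow:
  "0 \<le> t \<Longrightarrow> (\<lambda>n. picard (truncated N) w x n t) \<longlonglongrightarrow> truncated_flow w x N t"
  using lipschitz_on_truncated[of N] picard_converges(1)[OF _ w] unfolding truncated_flow_def by blast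

lemma solution_on_truncated_flow: "solution_on (truncated N) w x T (truncated_flow w x N)"
  using lipschitz_on_truncated[of N] picard_converges(2)[OF _ w] unfolding truncated_flow_def[abs_def] by blast

lemma truncated_flow_eventually_solution:
  "\<exists>N0. \<forall>N\<ge>N0. solution_on G w x T (truncated_flow w x N)"
proof -
  have wT: "continuous_on {0..T} w" using w by (rule continuous_on_subset) auto
  then have "bounded (w ` {0..T})"
    by (intro compact_imp_bounded compact_continuous_image) auto
  then obtain M where M: "\<And>s. s \<in> {0..T} \<Longrightarrow> norm (w s) \<le> M"
    unfolding bounded_iff by (metis imageI)
  obtain \<Lambda> where \<Lambda>: "\<Lambda>-lipschitz_on (cball 0 M) G"
    using lipschitz_on_balls by blast
  have C: "norm (G y) \<le> norm (G 0) + \<Lambda> * M" if y: "norm y \<le> M" for y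
  proof -
    have "norm (G y - G 0) \<le> \<Lambda> * norm (y - 0)"
      \<comment> \<open>The existence of such a y forces 0 \<le> M, so the ball also contains
        0.\<close>
      using lipschitz_onD[OF \<Lambda>, of y 0] y order_trans[OF norm_ge_zero y] unfolding dist_norm by auto
    also have "\<dots> \<le> \<Lambda> * M"
      using lipschitz_on_nonneg[OF \<Lambda>] y by (intro mult_left_mono) auto
    finally show ?thesis using norm_triangle_sub[of "G y" "G 0"] by linarith
  qed
  \<comment> \<open>The a priori bound on the solution minus the noise, taken at the final time,
    plus the bound \<open>M\<close> on the noise. It does not involve \<open>N\<close>, so once the
    radius exceeds it the retraction is the identity along the whole trajectory.\<close>
  define B where "B = sqrt (exp T * ((norm x)\<^sup>2 + (norm (G 0) + \<Lambda> * M)\<^sup>2)) + M"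
  obtain N0 where N0: "B \<le> real N0" using real_arch_simple by blast
  have "solution_on G w x T (truncated_flow w x N)" if N: "N \<ge> N0" for N
  proof -
    let ?u = "truncated_flow w x N"
    have "norm (?u t) \<le> real (Suc N)" if t: "t \<in> {0..T}" for t
    proof -
      have "(norm (?u t - w t))\<^sup>2 \<le> exp t * ((norm x)\<^sup>2 + (norm (G 0) + \<Lambda> * M)\<^sup>2)"
        using solution_on_truncated_flow[of N x T] unfolding truncated_def
        by (intro truncated_a_priori_bound[OF continuous dissipative _ wT M C]) (use t in auto)
      also have "\<dots> \<le> exp T * ((norm x)\<^sup>2 + (norm (G 0) + \<Lambda> * M)\<^sup>2)"
        using t by (intro mult_right_mono) auto
      finally have "norm (?u t - w t) \<le> B - M"
        unfolding B_def by (simp add: real_le_rsqrt)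
      then show ?thesis
        using M[OF t] norm_triangle_sub[of "?u t" "w t"] N0 N by linarith
    qed
    then have "truncated N (?u t) = G (?u t)" if "t \<in> {0..T}" for t
      using that by (simp add: truncated_def ball_retraction_id)
    then have "integral {0..t} (\<lambda>s. truncated N (?u s)) = integral {0..t} (\<lambda>s. G (?u s))"
      if "t \<in> {0..T}" for t
      using that by (intro integral_cong) auto
    with solution_on_truncated_flow[of N x T] show ?thesis
      by (simp add: solution_on_def)
  qed
  then show ?thesis by blast
qed

text \<open>For large \<open>N\<close> the truncated flows all solve the same original equation,
  which is dissipative, so they coincide by comparison. The limit over \<open>N\<close> is thus
  attained at a finite index, uniformly on the horizon.\<close>

lemma truncated_flow_eventually_flow:
  "\<exists>N0. \<forall>N\<ge>N0. \<forall>t\<in>{0..T}. truncated_flow w x N t = flow w x t"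
proof -
  obtain N0 where N0: "\<And>N. N \<ge> N0 \<Longrightarrow> solution_on G w x T (truncated_flow w x N)"
    using truncated_flow_eventually_solution by blast
  have eq: "truncated_flow w x N t = truncated_flow w x N0 t" if "N \<ge> N0" "t \<in> {0..T}" for N t
    using dissipative_comparison[OF continuous dissipative N0[OF that(1)] N0[OF order_refl] that(2)] by simp
  have "flow w x t = truncated_flow w x N0 t" if "t \<in> {0..T}" for t
  proof -
    have "\<forall>\<^sub>F N in sequentially. truncated_flow w x N t = truncated_flow w x N0 t"
      using eq that unfolding eventually_sequentially by blast
    then show ?thesis unfolding flow_def by (intro limI tendsto_eventually)
  qed
  with eq have "\<forall>N\<ge>N0. \<forall>t\<in>{0..T}. truncated_flow w x N t = flow w x t"
    by metis
  then show ?thesis ..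
qed

lemma truncated_flow_LIMSEQ_flow:
  assumes "0 \<le> t"
  shows "(\<lambda>N. truncated_flow w x N t) \<longlonglongrightarrow> flow w x t"
proof (rule tendsto_eventually)
  show "\<forall>\<^sub>F N in sequentially. truncated_flow w x N t = flow w x t"
    using truncated_flow_eventually_flow[of t x] assms unfolding eventually_sequentially by (meson atLeastAtMost_iff order_refl)
qed

lemma solution_on_flow: "solution_on G w x T (flow w x)"
proof -
  obtain N1 where N1: "\<And>N. N \<ge> N1 \<Longrightarrow> solution_on G w x T (truncated_flow w x N)"
    using truncated_flow_eventually_solution by blast
  obtain N2 where N2: "\<And>N t. N \<ge> N2 \<Longrightarrow> t \<in> {0..T} \<Longrightarrow> truncated_flow w x N t = flow w x t"
    using truncated_flow_eventually_flow by blast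
  let ?u = "truncated_flow w x (max N1 N2)"
  have eq: "?u t = flow w x t" if "t \<in> {0..T}" for t
    using N2[of "max N1 N2"] that by simp
  have "integral {0..t} (\<lambda>s. G (?u s)) = integral {0..t} (\<lambda>s. G (flow w x s))" if "t \<in> {0..T}" for t
    using that by (intro integral_cong) (simp add: eq)
  moreover have "continuous_on {0..T} ?u \<longleftrightarrow> continuous_on {0..T} (flow w x)"
    by (rule continuous_on_cong) (auto simp: eq)
  ultimately show ?thesis
    using N1[of "max N1 N2"] by (simp add: solution_on_def eq)
qed

lemma solution_on_flow_unique:
  assumes "solution_on G w x T v" "t \<in> {0..T}"
  shows "v t = flow w x t"
  using dissipative_comparison[OF continuous dissipative assms(1) solution_on_flow[of x] assms(2)] by simp

lemma continuous_on_flow: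
  assumes "0 \<le> t"
  shows "continuous_on UNIV (\<lambda>x. flow w x t)"
proof -
  have "1-lipschitz_on UNIV (\<lambda>x. flow w x t)"
    using dissipative_comparison[OF continuous dissipative solution_on_flow[of _ t] solution_on_flow[of _ t], of t] assms
    by (intro lipschitz_onI) (auto simp: dist_norm)
  then show ?thesis by (rule lipschitz_on_continuous_on)
qed

end

text \<open>Splitting the integral at time s shows that the translated solution starts at
  \<open>flow w x s\<close> and is driven by the increments of \<open>w\<close> after s. Uniqueness
  identifies it with the restarted flow.\<close>

lemma flow_cocycle:
  assumes w: "continuous_on {0..} w" and "0 \<le> s" "0 \<le> t"
  shows "flow w x (t + s) = flow (\<lambda>r. w (r + s) - w s) (flow w x s) t"
proof -
  let ?w' = "\<lambda>r. w (r + s) - w s"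
  have w': "continuous_on {0..} ?w'"
    by (intro continuous_intros continuous_on_compose2[OF w]) (use assms in auto)
  have sol: "solution_on G w x (t + s) (flow w x)" by (rule solution_on_flow[OF w])
  have cf: "continuous_on {0..t + s} (flow w x)" using sol by (simp add: solution_on_def)
  have c: "continuous_on {0..t + s} (\<lambda>r. G (flow w x r))"
    by (rule continuous_on_compose2[OF continuous cf]) auto
  have "flow w x (r + s) = flow w x s + integral {0..r} (\<lambda>q. G (flow w x (q + s))) + ?w' r"
    if r: "r \<in> {0..t}" for r
  proof -
    have "integral {0..s} (\<lambda>q. G (flow w x q)) + integral {s..r + s} (\<lambda>q. G (flow w x q)) =
        integral {0..r + s} (\<lambda>q. G (flow w x q))"
      using r assms
      by (intro Henstock_Kurzweil_Integration.integral_combine integrable_continuous_real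
          continuous_on_subset[OF c]) auto
    moreover have "integral {0..r} (\<lambda>q. G (flow w x (q + s))) = integral {s..r + s} (\<lambda>q. G (flow w x q))"
      using integral_shift_real_ivl[of s s "r + s" "\<lambda>q. G (flow w x q)"] by simp
    moreover have "flow w x (r + s) = x + integral {0..r + s} (\<lambda>q. G (flow w x q)) + w (r + s)"
      "flow w x s = x + integral {0..s} (\<lambda>q. G (flow w x q)) + w s"
      using sol r assms by (auto simp: solution_on_def)
    ultimately show ?thesis by (simp add: algebra_simps)
  qed
  moreover have "continuous_on {0..t} (\<lambda>r. flow w x (r + s))"
    by (rule continuous_on_compose2[OF cf]) (use assms in \<open>auto intro!: continuous_intros\<close>)
  ultimately have "solution_on G ?w' (flow w x s) t (\<lambda>r. flow w x (r + s))"
    by (simp add: solution_on_def)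
  from solution_on_flow_unique[OF w' this, of t] show ?thesis using assms by simp
qed

end

lemma pathwise_solution_iff_solution_on:
  assumes G: "continuous_on UNIV G"
  shows "pathwise_solution G w x u \<longleftrightarrow> (\<forall>T. solution_on G w x T u)"
proof
  assume u: "pathwise_solution G w x u"
  then have "continuous_on {0..T} u" for T
    unfolding pathwise_solution_def by (auto elim: continuous_on_subset)
  with u show "\<forall>T. solution_on G w x T u"
    unfolding pathwise_solution_def solution_on_def by simp
next
  assume u: "\<forall>T. solution_on G w x T u"
  then have c: "continuous_on {0..T} u" for T unfolding solution_on_def by blast
  have "(\<lambda>s. G (u s)) integrable_on {0..T}" for T
    by (intro integrable_continuous_real continuous_on_compose2[OF G c]) auto
  moreover have "continuous_on {0..} u" using c by (rule continuous_on_atLeastI)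
  moreover have "u t = x + integral {0..t} (\<lambda>s. G (u s)) + w t" if "0 \<le> t" for t
    using u[THEN spec, of t] that unfolding solution_on_def by simp
  ultimately show "pathwise_solution G w x u"
    unfolding pathwise_solution_def by blast
qed

section \<open>Measurability of the flow\<close>

text \<open>This turns a vector-valued gauge integral into a real Lebesgue integral over the whole
  line, with \<open>t\<close> only in the integrand; such parametrised integrals are measurable in
  the parameters.\<close>

lemma coord_integral:
  fixes h :: "real \<Rightarrow> ell2"
  assumes "continuous_on {0..t} h"
  shows "coord (integral {0..t} h) i = (\<integral>s. indicator {0..t} s *\<^sub>R coord (h s) i \<partial>lborel)"
proof -
  have "coord (integral {0..t} h) i = integral {0..t} (\<lambda>s. coord (h s) i)"
    using integral_linear[OF integrable_continuous_real[OF assms] bounded_linear_coord[of i]]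
    by (simp add: o_def)
  also have "\<dots> = (LINT s:{0..t}|lborel. coord (h s) i)"
    by (intro set_borel_integral_eq_integral(2)[symmetric] borel_integrable_atLeastAtMost'
      bounded_linear.continuous_on[OF bounded_linear_coord] assms)
  finally show ?thesis by (simp add: set_lebesgue_integral_def)
qed

lemma borel_measurable_picard:
  fixes G :: "ell2 \<Rightarrow> ell2" and W :: "real \<Rightarrow> 'w \<Rightarrow> ell2"
  assumes G: "continuous_on UNIV G"
    and W: "(\<lambda>(t, w). W t w) \<in> borel \<Otimes>\<^sub>M M \<rightarrow>\<^sub>M borel"
    and cW: "\<And>w. w \<in> space M \<Longrightarrow> continuous_on {0..} (\<lambda>t. W t w)"
  shows "(\<lambda>(t, w, x). picard G (\<lambda>t. W t w) x n t) \<in> borel \<Otimes>\<^sub>M M \<Otimes>\<^sub>M borel \<rightarrow>\<^sub>M borel"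
proof (induction n)
  case 0
  show ?case by simp
next
  case (Suc n)
  show ?case
  proof (rule borel_measurable_ell2I)
    fix i
    have "(\<lambda>(t, w, x). coord x i +
        (\<integral>s. (if 0 \<le> s \<and> s \<le> t then 1 else 0) *\<^sub>R coord (G (picard G (\<lambda>t. W t w) x n s)) i \<partial>lborel) +
        coord (W t w) i) \<in> borel_measurable (borel \<Otimes>\<^sub>M M \<Otimes>\<^sub>M borel)"
    proof -
      let ?X = "(borel :: real measure) \<Otimes>\<^sub>M M \<Otimes>\<^sub>M (borel :: ell2 measure)"
      let ?p = "\<lambda>z s. picard G (\<lambda>t. W t (fst (snd z))) (snd (snd z)) n s"
      \<comment> \<open>Here z = ((t, w, x), s) is sent to (s, w, x), so the induction hypothesis is
        used at the integration time.\<close>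
      have "(\<lambda>z. (snd z, fst (snd (fst z)), snd (snd (fst z)))) \<in> ?X \<Otimes>\<^sub>M lborel \<rightarrow>\<^sub>M ?X"
        by measurable
      from measurable_compose[OF this Suc]
      have p: "(\<lambda>z. ?p (fst z) (snd z)) \<in> ?X \<Otimes>\<^sub>M lborel \<rightarrow>\<^sub>M borel"
        by (simp add: case_prod_unfold)
      have c: "(\<lambda>z. coord (G (?p (fst z) (snd z))) i) \<in> borel_measurable (?X \<Otimes>\<^sub>M lborel)"
        by (intro measurable_compose[OF measurable_compose[OF p] borel_measurable_coord]
          borel_measurable_continuous_onI G)
      have "(\<lambda>z. if 0 \<le> snd z \<and> snd z \<le> fst (fst z) then 1 else 0 :: real) \<in> borel_measurable (?X \<Otimes>\<^sub>M lborel)"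
        by measurable
      from borel_measurable_scaleR[OF this c]
      have "(\<lambda>z. \<integral>s. (if 0 \<le> s \<and> s \<le> fst z then 1 else 0) *\<^sub>R coord (G (?p z s)) i \<partial>lborel) \<in> borel_measurable ?X"
        by (intro lborel.borel_measurable_lebesgue_integral) (simp add: case_prod_unfold)
      moreover have "(\<lambda>z. coord (snd (snd z)) i) \<in> borel_measurable ?X"
        by measurable
      moreover have "(\<lambda>z. coord (W (fst z) (fst (snd z))) i) \<in> borel_measurable ?X"
      proof -
        have "(\<lambda>z. (fst z, fst (snd z))) \<in> ?X \<rightarrow>\<^sub>M borel \<Otimes>\<^sub>M M" by measurable
        from measurable_compose[OF measurable_compose[OF this W] borel_measurable_coord] show ?thesis by simp
      qed
      ultimately show ?thesis
        unfolding case_prod_unfold by (intro borel_measurable_add)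
    qed
    then show "(\<lambda>z. coord (case z of (t, w, x) \<Rightarrow> picard G (\<lambda>t. W t w) x (Suc n) t) i)
        \<in> borel_measurable (borel \<Otimes>\<^sub>M M \<Otimes>\<^sub>M borel)"
    proof (rule measurable_cong[THEN iffD1, rotated])
      fix z assume "z \<in> space ((borel :: real measure) \<Otimes>\<^sub>M M \<Otimes>\<^sub>M (borel :: ell2 measure))"
      then obtain t w x where z: "z = (t, w, x)" and w: "w \<in> space M"
        by (auto simp: space_pair_measure)
      \<comment> \<open>Paths are known to be continuous only for w in the space of
        \<open>M\<close>; agreement of the two expressions there suffices for measurability.\<close>
      have "continuous_on {0..t} (\<lambda>s. G (picard G (\<lambda>t. W t w) x n s))"
        by (rule continuous_on_compose2[OF G continuous_on_picard[OF G continuous_on_subset[OF cW[OF w]]]]) auto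
      from coord_integral[OF this, of i]
      show "(case z of (t, w, x) \<Rightarrow> coord x i +
          (\<integral>s. (if 0 \<le> s \<and> s \<le> t then 1 else 0) *\<^sub>R coord (G (picard G (\<lambda>t. W t w) x n s)) i \<partial>lborel) +
          coord (W t w) i) = coord (case z of (t, w, x) \<Rightarrow> picard G (\<lambda>t. W t w) x (Suc n) t) i"
        by (simp add: z coord_add indicator_def of_bool_def)
    qed
  qed
qed

text \<open>Limits are taken first over iterates, then over radii. Their convergence is available
  for nonnegative times, hence the restricted time space.\<close>

lemma borel_measurable_flow:
  fixes G :: "ell2 \<Rightarrow> ell2" and W :: "real \<Rightarrow> 'w \<Rightarrow> ell2"
  assumes "dissipative_field G"
    and W: "(\<lambda>(t, w). W t w) \<in> borel \<Otimes>\<^sub>M M \<rightarrow>\<^sub>M borel"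
    and cW: "\<And>w. w \<in> space M \<Longrightarrow> continuous_on {0..} (\<lambda>t. W t w)"
  shows "(\<lambda>(t, w, x). dissipative_field.flow G (\<lambda>t. W t w) x t) \<in>
    restrict_space borel {0..} \<Otimes>\<^sub>M M \<Otimes>\<^sub>M borel \<rightarrow>\<^sub>M borel"
proof -
  interpret dissipative_field G by fact
  let ?X = "restrict_space borel {0..} \<Otimes>\<^sub>M M \<Otimes>\<^sub>M (borel :: ell2 measure)"
  have id: "(\<lambda>(t, w, x). (t, w, x)) \<in> ?X \<rightarrow>\<^sub>M (borel :: real measure) \<Otimes>\<^sub>M M \<Otimes>\<^sub>M borel"
  proof -
    have [measurable]: "(\<lambda>t. t) \<in> restrict_space borel {0..} \<rightarrow>\<^sub>M (borel :: real measure)"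
      by (rule measurable_restrict_space1) simp
    show ?thesis by measurable
  qed
  have p: "(\<lambda>(t, w, x). picard (truncated N) (\<lambda>t. W t w) x n t) \<in> ?X \<rightarrow>\<^sub>M borel" for N n
    using measurable_compose[OF id borel_measurable_picard[OF continuous_on_truncated W cW]]
    by (simp add: case_prod_unfold)
  have "(\<lambda>(t, w, x). truncated_flow (\<lambda>t. W t w) x N t) \<in> ?X \<rightarrow>\<^sub>M borel" for N
    by (rule borel_measurable_LIMSEQ_metric[OF p])
      (auto simp: space_pair_measure space_restrict_space intro!: picard_LIMSEQ_truncated_flow cW)
  then show ?thesis
    by (rule borel_measurable_LIMSEQ_metric)
      (auto simp: space_pair_measure space_restrict_space intro!: truncated_flow_LIMSEQ_flow cW)
qed

text \<open>Rounding time down to a grid of mesh 1/(n+1) leaves countably many values, so the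
  rounded process is jointly measurable; continuity of paths recovers the process as the mesh
  shrinks.\<close>

lemma borel_measurable_continuous_process:
  fixes X :: "real \<Rightarrow> 'w \<Rightarrow> 'a::metric_space"
  assumes X: "\<And>t. X t \<in> borel_measurable M"
    and c: "\<And>w. w \<in> space M \<Longrightarrow> continuous_on UNIV (\<lambda>t. X t w)"
  shows "(\<lambda>(t, w). X t w) \<in> borel \<Otimes>\<^sub>M M \<rightarrow>\<^sub>M borel"
proof (rule borel_measurable_LIMSEQ_metric)
  fix n
  show "(\<lambda>(t, w). X (\<lfloor>t * real (Suc n)\<rfloor> / real (Suc n)) w) \<in> borel \<Otimes>\<^sub>M M \<rightarrow>\<^sub>M borel"
  proof -
    have "(\<lambda>z. X (real_of_int i / real (Suc n)) (snd z)) \<in> (borel :: real measure) \<Otimes>\<^sub>M M \<rightarrow>\<^sub>M borel" for i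
      using X by (rule measurable_compose[OF measurable_snd])
    moreover have "(\<lambda>z. \<lfloor>fst z * real (Suc n)\<rfloor>) \<in> borel \<Otimes>\<^sub>M M \<rightarrow>\<^sub>M count_space UNIV"
      by measurable
    ultimately have "(\<lambda>z. X (real_of_int \<lfloor>fst z * real (Suc n)\<rfloor> / real (Suc n)) (snd z)) \<in> borel \<Otimes>\<^sub>M M \<rightarrow>\<^sub>M borel"
      by (rule measurable_compose_countable)
    then show ?thesis by (simp add: case_prod_unfold)
  qed
next
  fix z :: "real \<times> 'w" assume "z \<in> space (borel \<Otimes>\<^sub>M M)"
  then obtain t w where z: "z = (t, w)" and w: "w \<in> space M"
    by (auto simp: space_pair_measure)
  have "(\<lambda>n. real_of_int \<lfloor>t * real (Suc n)\<rfloor> / real (Suc n) - t) \<longlonglongrightarrow> 0"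
  proof (rule Lim_null_comparison)
    have "norm (real_of_int \<lfloor>t * real (Suc n)\<rfloor> / real (Suc n) - t) \<le> inverse (real (Suc n))" for n
    proof -
      have "real_of_int \<lfloor>t * real (Suc n)\<rfloor> / real (Suc n) - t = (real_of_int \<lfloor>t * real (Suc n)\<rfloor> - t * real (Suc n)) / real (Suc n)"
        by (simp add: field_simps)
      also have "norm \<dots> \<le> 1 / real (Suc n)"
        unfolding norm_divide by (intro frac_le) (simp_all, linarith)
      finally show ?thesis by (simp add: inverse_eq_divide)
    qed
    then show "\<forall>\<^sub>F n in sequentially. norm (real_of_int \<lfloor>t * real (Suc n)\<rfloor> / real (Suc n) - t) \<le> inverse (real (Suc n))"
      by (intro always_eventually) blast
  qed (rule LIMSEQ_inverse_real_of_nat)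
  then have "(\<lambda>n. real_of_int \<lfloor>t * real (Suc n)\<rfloor> / real (Suc n)) \<longlonglongrightarrow> t"
    by (rule LIM_zero_cancel)
  moreover have "isCont (\<lambda>t. X t w) t"
    using c[OF w] by (simp add: continuous_on_eq_continuous_at)
  ultimately have "(\<lambda>n. X (real_of_int \<lfloor>t * real (Suc n)\<rfloor> / real (Suc n)) w) \<longlonglongrightarrow> X t w"
    by (rule isCont_tendsto_compose[rotated])
  then show "(\<lambda>n. (case z of (t, w) \<Rightarrow> X (\<lfloor>t * real (Suc n)\<rfloor> / real (Suc n)) w)) \<longlonglongrightarrow> (case z of (t, w) \<Rightarrow> X t w)"
    by (simp add: z)
qed

section \<open>The noise\<close>

text \<open>An infinite sum that does not converge has the default value 0, so convergence must be
  assumed before the continuous coordinate functional is applied termwise.\<close>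

lemma coord_noise:
  assumes "noise_converges \<sigma> \<omega>"
  shows "coord (noise \<sigma> t \<omega>) i = coord \<sigma> i * \<omega> t i"
proof -
  have "((\<lambda>j. (coord \<sigma> j * \<omega> t j) *\<^sub>R unit_seq j) has_sum noise \<sigma> t \<omega>) UNIV"
    using assms unfolding noise_converges_def noise_def by (intro has_sum_infsum) blast
  from has_sum_bounded_linear[OF bounded_linear_coord this, of i]
  have "((\<lambda>j. if j = i then coord \<sigma> i * \<omega> t i else 0) has_sum coord (noise \<sigma> t \<omega>) i) UNIV"
    by (simp add: coord_scaleR coord_unit_seq if_distrib eq_commute[of i] cong: if_cong)
  moreover have "((\<lambda>j. if j = i then coord \<sigma> i * \<omega> t i else 0) has_sum (coord \<sigma> i * \<omega> t i)) UNIV"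
    using has_sum_finite[of "{i}" "\<lambda>j. coord \<sigma> i * \<omega> t i", simplified]
    by (rule has_sum_cong_neutral[THEN iffD1, rotated -1]) auto
  ultimately show ?thesis by (rule has_sum_unique)
qed

text \<open>This links the shift of paths to the driving path of the restarted equation in the
  cocycle property.\<close>

lemma noise_path_shift:
  assumes "noise_converges \<sigma> \<omega>" "noise_converges \<sigma> (path_shift s \<omega>)"
  shows "noise \<sigma> t (path_shift s \<omega>) = noise \<sigma> (t + s) \<omega> - noise \<sigma> s \<omega>"
  by (rule ell2_eqI)
    (simp only: coord_diff coord_noise[OF assms(1)] coord_noise[OF assms(2)], simp add: path_shift_def algebra_simps)

lemma fbm_distribution_space:
  assumes "fbm_distribution H P" "\<omega> \<in> space P"
  shows "\<omega> 0 i = 0"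
proof -
  have "space P = space path_borel"
    using assms(1) by (intro sets_eq_imp_space_eq) (simp add: fbm_distribution_def)
  then show ?thesis
    using assms(2) by (simp add: path_borel_def space_measure_of_conv path_space_def)
qed

lemma fbm_distribution_measurable_coordinate:
  assumes "fbm_distribution H P"
  shows "(\<lambda>\<omega>. \<omega> t i) \<in> borel_measurable P"
proof -
  have "gaussian_process P (\<lambda>t \<omega>. \<omega> t i)"
    using assms unfolding fbm_distribution_def two_sided_fbm_def by blast
  \<comment> \<open>The linear combination with the single time t and coefficient 1 is the
    coordinate itself, and Gaussian variables are measurable by definition.\<close>
  then have "finite {t} \<longrightarrow> gaussian_rv P (\<lambda>\<omega>. \<Sum>r\<in>{t}. 1 * \<omega> r i)"
    unfolding gaussian_process_def by (elim allE)
  then show ?thesis by (simp add: gaussian_rv_def)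
qed

section \<open>Restriction of a metric dynamical system to an invariant set of full measure\<close>

lemma metric_dynamical_system_restrict_space:
  assumes M: "metric_dynamical_system M \<theta>"
    and \<Omega>: "\<Omega> \<in> sets M" "measure M \<Omega> = 1"
    and inv: "\<And>t w. w \<in> \<Omega> \<Longrightarrow> \<theta> t w \<in> \<Omega>"
  shows "metric_dynamical_system (restrict_space M \<Omega>) \<theta>"
proof -
  let ?R = "restrict_space M \<Omega>"
  interpret prob_space M using M by (simp add: metric_dynamical_system_def)
  have sp: "space ?R = \<Omega>" using \<Omega> by simp
  have sub: "w \<in> space M" if "w \<in> \<Omega>" for w using \<Omega>(1) that sets.sets_into_space by blast
  have joint: "(\<lambda>(t, w). \<theta> t w) \<in> borel \<Otimes>\<^sub>M M \<rightarrow>\<^sub>M M"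
    using M by (simp add: metric_dynamical_system_def)
  have meas: "\<theta> t \<in> M \<rightarrow>\<^sub>M M" for t
    using measurable_compose[OF measurable_Pair1'[of t borel M] joint] by simp
  have measR: "\<theta> t \<in> ?R \<rightarrow>\<^sub>M ?R" for t
    by (intro measurable_restrict_space2 measurable_restrict_space1 meas) (use inv sp in auto)
  have "(\<lambda>(t, w). \<theta> t w) \<in> borel \<Otimes>\<^sub>M ?R \<rightarrow>\<^sub>M ?R"
  proof (rule measurable_restrict_space2)
    show "(\<lambda>(t, w). \<theta> t w) \<in> space (borel \<Otimes>\<^sub>M ?R) \<rightarrow> \<Omega>"
      using inv sp by (auto simp: space_pair_measure)
    have [measurable]: "(\<lambda>w. w) \<in> ?R \<rightarrow>\<^sub>M M" by (rule measurable_restrict_space1) simp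
    have "(\<lambda>(t, w). (t, w)) \<in> (borel :: real measure) \<Otimes>\<^sub>M ?R \<rightarrow>\<^sub>M borel \<Otimes>\<^sub>M M" by measurable
    from measurable_compose[OF this joint] show "(\<lambda>(t, w). \<theta> t w) \<in> borel \<Otimes>\<^sub>M ?R \<rightarrow>\<^sub>M M"
      by (simp add: case_prod_unfold)
  qed
  moreover have "distr ?R ?R (\<theta> t) = ?R" for t
  proof (rule measure_eqI)
    fix A assume "A \<in> sets (distr ?R ?R (\<theta> t))"
    then have AR: "A \<in> sets ?R" by simp
    then have A: "A \<in> sets M" "A \<subseteq> \<Omega>" using \<Omega>(1) by (auto simp: sets_restrict_space_iff)
    have "emeasure (distr ?R ?R (\<theta> t)) A = emeasure ?R (\<theta> t -` A \<inter> \<Omega>)"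
      using emeasure_distr[OF measR AR] sp by simp
    also have "\<dots> = emeasure M (\<theta> t -` A \<inter> \<Omega>)"
      using \<Omega>(1) by (intro emeasure_restrict_space) auto
    \<comment> \<open>The two preimages differ only outside \<Omega>, a null set, so invariance of
      the full measure carries over.\<close>
    also have "\<dots> = emeasure M (\<theta> t -` A \<inter> space M)"
    proof (rule emeasure_eq_AE)
      show "AE w in M. w \<in> \<theta> t -` A \<inter> \<Omega> \<longleftrightarrow> w \<in> \<theta> t -` A \<inter> space M"
        using AE_prob_1[OF \<Omega>(2)] by eventually_elim (auto simp: sub)
      show "\<theta> t -` A \<inter> space M \<in> sets M" using measurable_sets[OF meas A(1)] .
      moreover have "\<theta> t -` A \<inter> \<Omega> = (\<theta> t -` A \<inter> space M) \<inter> \<Omega>" using sub by auto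
      ultimately show "\<theta> t -` A \<inter> \<Omega> \<in> sets M" using \<Omega>(1) by auto
    qed
    also have "\<dots> = emeasure (distr M M (\<theta> t)) A"
      using emeasure_distr[OF meas A(1)] by simp
    also have "\<dots> = emeasure M A"
      using M by (simp add: metric_dynamical_system_def)
    also have "\<dots> = emeasure ?R A"
      using \<Omega>(1) A by (simp add: emeasure_restrict_space)
    finally show "emeasure (distr ?R ?R (\<theta> t)) A = emeasure ?R A" .
  qed simp
  moreover have "prob_space ?R"
    using \<Omega> by (intro prob_space_restrict_space) (auto simp: emeasure_eq_measure)
  ultimately show ?thesis
    using M sub sp unfolding metric_dynamical_system_def by auto
qed

section \<open>The drift\<close>

text \<open>Only derivatives along one segment enter the mean value inequality, and the segment
  stays in the ball by convexity; a Gateaux derivative therefore suffices.\<close>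

lemma gateaux_lipschitz_on_cball:
  fixes F :: "'a::real_normed_vector \<Rightarrow> 'b::real_normed_vector"
  assumes D: "\<And>x. has_gateaux_derivative F (D x) x"
    and B: "\<And>x. norm x \<le> R \<Longrightarrow> onorm (D x) \<le> B"
    and "0 \<le> B"
  shows "B-lipschitz_on (cball 0 R) F"
proof (rule lipschitz_onI)
  fix x y :: 'a assume xy: "x \<in> cball 0 R" "y \<in> cball 0 R"
  define h where "h = x - y"
  have "norm (F (y + 1 *\<^sub>R h) - F (y + 0 *\<^sub>R h)) \<le> B * norm h * norm (1 - 0 :: real)"
  proof (rule differentiable_bound[of "{0..1}" "\<lambda>s. F (y + s *\<^sub>R h)" "\<lambda>s r. r *\<^sub>R D (y + s *\<^sub>R h) h"])
    fix s :: real assume s: "s \<in> {0..1}"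
    have "((\<lambda>r. F ((y + s *\<^sub>R h) + r *\<^sub>R h)) has_vector_derivative D (y + s *\<^sub>R h) h) (at 0)"
      using D unfolding has_gateaux_derivative_def by blast
    \<comment> \<open>The derivative at 0 from the base point y + s h is moved to a derivative at s
      from y; writing 0 as s - s lets the chain rule match.\<close>
    then have "((\<lambda>r. F (y + s *\<^sub>R h + r *\<^sub>R h)) has_vector_derivative D (y + s *\<^sub>R h) h) (at (s - s))" by simp
    then have "(((\<lambda>r. F (y + s *\<^sub>R h + r *\<^sub>R h)) \<circ> (\<lambda>r. r - s)) has_vector_derivative (1 *\<^sub>R D (y + s *\<^sub>R h) h)) (at s)"
      by (intro vector_diff_chain_at) (auto intro!: derivative_eq_intros)
    then have "((\<lambda>r. F (y + r *\<^sub>R h)) has_vector_derivative D (y + s *\<^sub>R h) h) (at s)"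
      by (simp add: o_def algebra_simps)
    then show "((\<lambda>r. F (y + r *\<^sub>R h)) has_derivative (\<lambda>r. r *\<^sub>R D (y + s *\<^sub>R h) h)) (at s within {0..1})"
      unfolding has_vector_derivative_def by (rule has_derivative_at_withinI)
    have bl: "bounded_linear (D (y + s *\<^sub>R h))"
      using D unfolding has_gateaux_derivative_def by blast
    have "y + s *\<^sub>R h = (1 - s) *\<^sub>R y + s *\<^sub>R x" by (simp add: h_def algebra_simps)
    also have "\<dots> \<in> cball 0 R"
      using convex_cball xy s by (intro convexD) auto
    finally have "norm (D (y + s *\<^sub>R h) h) \<le> B * norm h"
      using order_trans[OF onorm[OF bl, of h] mult_right_mono[OF B norm_ge_zero]] by simp
    then show "onorm (\<lambda>r. r *\<^sub>R D (y + s *\<^sub>R h) h) \<le> B * norm h"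
      by (intro onorm_le) (simp add: mult.commute[of _ "\<bar>_\<bar>"] mult_left_mono)
  qed auto
  then show "dist (F x) (F y) \<le> B * dist x y" by (simp add: h_def dist_norm)
qed fact

text \<open>The forcing \<open>g\<close> cancels in differences, and the nonlinearity, the lattice
  operator and the damping each contribute a nonpositive term.\<close>

lemma dissipative_field_drift:
  assumes pos: "\<kappa> > 0" "lam > 0" "L > 0" "K > 0" "p \<ge> 1"
    and Df: "\<And>x. has_gateaux_derivative (superpos f) (Df x) x"
    and dissipative: "\<And>x y. (x - y) \<bullet> (superpos f x - superpos f y) \<le> - L * (norm (x - y))\<^sup>2"
    and growth: "\<And>x. norm (superpos f x) + onorm (Df x) \<le> K * (1 + norm x powr p)"
  shows "dissipative_field (drift \<kappa> lam f g)"
proof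
  have diff: "drift \<kappa> lam f g x - drift \<kappa> lam f g y =
      (superpos f x - superpos f y) - \<kappa> *\<^sub>R lattice_op (x - y) - lam *\<^sub>R (x - y)" for x y
    by (simp add: drift_def lattice_op_diff algebra_simps)
  fix R :: real
  \<comment> \<open>The growth bound with the norm of \<open>superpos f x\<close> dropped. The
    absolute value makes the power monotone without assuming R nonnegative.\<close>
  define B where "B = K * (1 + \<bar>R\<bar> powr p)"
  have "onorm (Df x) \<le> B" if "norm x \<le> R" for x
  proof -
    have "norm x powr p \<le> \<bar>R\<bar> powr p" using pos that by (intro powr_mono2) auto
    then have "K * (1 + norm x powr p) \<le> B" unfolding B_def using pos by simp
    then show ?thesis using growth[of x] norm_ge_zero[of "superpos f x"] by linarith
  qed
  moreover have B: "0 \<le> B" using pos by (simp add: B_def)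
  ultimately have lip: "B-lipschitz_on (cball 0 R) (superpos f)"
    by (intro gateaux_lipschitz_on_cball[OF Df])
  have "(B + \<kappa> * 4 + lam)-lipschitz_on (cball 0 R) (drift \<kappa> lam f g)"
  proof (rule lipschitz_onI)
    fix x y :: ell2 assume "x \<in> cball 0 R" "y \<in> cball 0 R"
    then have "norm (superpos f x - superpos f y) \<le> B * norm (x - y)"
      using lipschitz_onD[OF lip] by (simp add: dist_norm)
    moreover have "norm (drift \<kappa> lam f g x - drift \<kappa> lam f g y) \<le>
        norm (superpos f x - superpos f y) + norm (\<kappa> *\<^sub>R lattice_op (x - y)) + norm (lam *\<^sub>R (x - y))"
      unfolding diff by (intro norm_triangle_le_diff add_mono order_refl norm_triangle_ineq4)
    moreover have "norm (\<kappa> *\<^sub>R lattice_op (x - y)) \<le> \<kappa> * (4 * norm (x - y))"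
      using norm_lattice_op[of "x - y"] pos by simp
    moreover have "norm (lam *\<^sub>R (x - y)) = lam * norm (x - y)" using pos by simp
    ultimately have "norm (drift \<kappa> lam f g x - drift \<kappa> lam f g y) \<le>
        B * norm (x - y) + \<kappa> * (4 * norm (x - y)) + lam * norm (x - y)"
      by linarith
    then show "dist (drift \<kappa> lam f g x) (drift \<kappa> lam f g y) \<le> (B + \<kappa> * 4 + lam) * dist x y"
      by (simp add: dist_norm distrib_right)
  qed (use B pos in simp)
  then show "\<exists>\<Lambda>. \<Lambda>-lipschitz_on (cball 0 R) (drift \<kappa> lam f g)" by blast
  fix x y :: ell2
  have "0 \<le> \<kappa> * ((x - y) \<bullet> lattice_op (x - y))" using lattice_op_nonneg pos by simp
  moreover have "0 \<le> lam * ((x - y) \<bullet> (x - y))" "0 \<le> L * (norm (x - y))\<^sup>2" using pos by simp_all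
  ultimately show "(x - y) \<bullet> (drift \<kappa> lam f g x - drift \<kappa> lam f g y) \<le> 0"
    using dissipative[of x y] unfolding diff inner_diff_right[of "x - y"] inner_scaleR_right by linarith
qed

section \<open>The random dynamical system of the lattice equation\<close>

theorem proposition3p2:
  fixes H \<kappa> lam L K p :: real
    and g \<sigma> :: ell2
    and f :: "int \<Rightarrow> real \<Rightarrow> real"
    and Df :: "ell2 \<Rightarrow> ell2 \<Rightarrow> ell2"
    and P :: "path measure"
    and \<Omega> :: "path set"
    and \<rho> :: "path \<Rightarrow> real"
  assumes hurst: "1/2 < H" "H < 1"
    and pos: "\<kappa> > 0" "lam > 0" "L > 0" "K > 0" "p \<ge> 1"
    and f_C1: "\<And>i. f i C1_differentiable_on UNIV"
    and f_maps: "\<And>x. square_summable (\<lambda>i. f i (coord x i))"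
    and Df: "\<And>x. has_gateaux_derivative (superpos f) (Df x) x"
    and dissipative: "\<And>x y. (x - y) \<bullet> (superpos f x - superpos f y) \<le> - L * (norm (x - y))\<^sup>2"
    and growth: "\<And>x. norm (superpos f x) + onorm (Df x) \<le> K * (1 + norm x powr p)"
    and fbm: "fbm_distribution H P"
    and mds: "ergodic_mds P path_shift"
    and full: "\<Omega> \<in> sets P" "measure P \<Omega> = 1"
    and invariant: "\<And>t \<omega>. \<omega> \<in> \<Omega> \<Longrightarrow> path_shift t \<omega> \<in> \<Omega>"
    and noise_ell2: "\<And>\<omega>. \<omega> \<in> \<Omega> \<Longrightarrow> noise_converges \<sigma> \<omega>"
    and noise_cont: "\<And>\<omega>. \<omega> \<in> \<Omega> \<Longrightarrow> continuous_on UNIV (\<lambda>t. noise \<sigma> t \<omega>)"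
    and rho_meas: "\<rho> \<in> borel_measurable (restrict_space P \<Omega>)"
    and rho_pos: "\<And>\<omega>. \<omega> \<in> \<Omega> \<Longrightarrow> \<rho> \<omega> > 0"
    and noise_growth: "\<And>t \<omega>. \<omega> \<in> \<Omega> \<Longrightarrow> norm (noise \<sigma> t \<omega>) \<le> \<rho> \<omega> * (1 + \<bar>t\<bar>\<^sup>2)"
  shows "\<exists>\<phi>. continuous_rds (restrict_space P \<Omega>) path_shift \<phi> \<and>
    (\<forall>\<omega>\<in>\<Omega>. \<forall>u0. \<exists>u.
      unique_pathwise_solution (drift \<kappa> lam f g) (\<lambda>t. noise \<sigma> t \<omega>) u0 u \<and>
      (\<forall>t\<ge>0. \<phi> t \<omega> u0 = u t \<and>
        \<phi> t \<omega> u0 = u0 + integral {0..t} (\<lambda>s. drift \<kappa> lam f g (u s)) + noise \<sigma> t \<omega>))"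
proof -
  let ?G = "drift \<kappa> lam f g" and ?W = "\<lambda>\<omega> t. noise \<sigma> t \<omega>" and ?R = "restrict_space P \<Omega>"
  interpret dissipative_field ?G
    using pos Df dissipative growth by (rule dissipative_field_drift)
  define \<phi> where "\<phi> t \<omega> x = flow (?W \<omega>) x t" for t \<omega> x
  have sp: "space ?R = \<Omega>" using full by simp
  have W: "continuous_on {0..} (?W \<omega>)" if "\<omega> \<in> \<Omega>" for \<omega>
    using noise_cont[OF that] by (rule continuous_on_subset) simp
  have sol: "solution_on ?G (?W \<omega>) x T (flow (?W \<omega>) x)" if "\<omega> \<in> \<Omega>" for \<omega> x T
    using W[OF that] by (rule solution_on_flow)
  have "noise \<sigma> t \<in> borel_measurable ?R" for t
  proof (rule borel_measurable_ell2I)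
    fix i
    have "(\<lambda>\<omega>. coord \<sigma> i * \<omega> t i) \<in> borel_measurable ?R"
      by (intro borel_measurable_times borel_measurable_const measurable_restrict_space1
        fbm_distribution_measurable_coordinate[OF fbm])
    then show "(\<lambda>\<omega>. coord (noise \<sigma> t \<omega>) i) \<in> borel_measurable ?R"
      by (rule measurable_cong[THEN iffD1, rotated]) (simp add: sp coord_noise noise_ell2)
  qed
  then have noise_meas: "(\<lambda>(t, \<omega>). noise \<sigma> t \<omega>) \<in> borel \<Otimes>\<^sub>M ?R \<rightarrow>\<^sub>M borel"
    by (rule borel_measurable_continuous_process) (simp add: sp noise_cont)
  \<comment> \<open>At time 0 the integral equation gives u0 plus the noise at 0, so the identity
    property of the flow rests on paths starting at 0.\<close>
  have noise_0: "noise \<sigma> 0 \<omega> = 0" if "\<omega> \<in> \<Omega>" for \<omega>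
  proof (rule ell2_eqI)
    have "\<omega> \<in> space P" using full(1) that sets.sets_into_space by blast
    then show "coord (noise \<sigma> 0 \<omega>) i = coord 0 i" for i
      using noise_ell2[OF that] fbm_distribution_space[OF fbm] by (simp add: coord_noise coord_zero)
  qed
  have "continuous_rds ?R path_shift \<phi>"
    unfolding continuous_rds_def
  proof (intro conjI allI ballI impI)
    show "metric_dynamical_system ?R path_shift"
      using mds full invariant unfolding ergodic_mds_def
      by (intro metric_dynamical_system_restrict_space) auto
    show "(\<lambda>(t, \<omega>, x). \<phi> t \<omega> x) \<in> restrict_space borel {0..} \<Otimes>\<^sub>M ?R \<Otimes>\<^sub>M borel \<rightarrow>\<^sub>M borel"
      unfolding \<phi>_def by (rule borel_measurable_flow[OF dissipative_field_axioms noise_meas]) (simp add: sp W)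
    show "\<phi> 0 \<omega> x = x" if "\<omega> \<in> space ?R" for \<omega> x
      using sol[of \<omega> x 0] noise_0[of \<omega>] that unfolding \<phi>_def sp solution_on_def by simp
    show "\<phi> (t + s) \<omega> = \<phi> t (path_shift s \<omega>) \<circ> \<phi> s \<omega>"
      if "0 \<le> s" "0 \<le> t" "\<omega> \<in> space ?R" for s t \<omega>
    proof
      fix x
      have "\<omega> \<in> \<Omega>" using that sp by simp
      \<comment> \<open>Invariance of \<Omega> supplies convergence of the noise for the shifted
        path.\<close>
      then have "?W (path_shift s \<omega>) = (\<lambda>r. ?W \<omega> (r + s) - ?W \<omega> s)"
        using noise_path_shift[OF noise_ell2 noise_ell2[OF invariant]] by blast
      then show "\<phi> (t + s) \<omega> x = (\<phi> t (path_shift s \<omega>) \<circ> \<phi> s \<omega>) x"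
        unfolding \<phi>_def o_def using flow_cocycle[OF W[OF \<open>\<omega> \<in> \<Omega>\<close>] that(1,2)] by simp
    qed
    show "continuous_on UNIV (\<phi> t \<omega>)" if "0 \<le> t" "\<omega> \<in> space ?R" for t \<omega>
      unfolding \<phi>_def using that sp W by (intro continuous_on_flow) auto
  qed
  moreover have "\<exists>u. unique_pathwise_solution ?G (?W \<omega>) x u \<and>
      (\<forall>t\<ge>0. \<phi> t \<omega> x = u t \<and> \<phi> t \<omega> x = x + integral {0..t} (\<lambda>s. ?G (u s)) + noise \<sigma> t \<omega>)"
    if \<omega>: "\<omega> \<in> \<Omega>" for \<omega> x
  proof (intro exI conjI allI impI)
    \<comment> \<open>Uniqueness at time t is uniqueness on the horizon T = t.\<close>
    show "unique_pathwise_solution ?G (?W \<omega>) x (flow (?W \<omega>) x)"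
      unfolding unique_pathwise_solution_def pathwise_solution_iff_solution_on[OF continuous]
      using sol[OF \<omega>] solution_on_flow_unique[OF W[OF \<omega>]] by (meson atLeastAtMost_iff order_refl)
    fix t :: real assume "0 \<le> t"
    then show "\<phi> t \<omega> x = x + integral {0..t} (\<lambda>s. ?G (flow (?W \<omega>) x s)) + noise \<sigma> t \<omega>"
      using sol[OF \<omega>, of x t] unfolding \<phi>_def solution_on_def by auto
  qed (simp add: \<phi>_def)
  ultimately show ?thesis by blast
qed

end
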